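(* For every $n\ge1$, let $A_n=\{f(P): f \text{ a symmetric and honest } n\text{-player tournament map},\ P\in\mathcal{D}_n\}$, and let $\mathcal{A}_n$ be the closure of the set of all win vectors $\boldsymbol{wv}(\boldsymbol{T},P)$ with $\boldsymbol{T}$ a symmetric and honest $n$-player tournament and $P\in\mathcal{D}_n$. Then $A_n=\mathcal{A}_n$, and this set is a finite union of convex polytopes in $\mathbb{R}^n$ (a convex polytope being the convex hull of a finite set of points).
   Context: Write $[n]=\{1,\dots,n\}$ for the set of players. Let $\mathcal{M}_n=\{P=(p_{ij})\in[0,1]^{n\times n}: P+P^T=\mathbf{1}\}$, where $\mathbf{1}$ is the all-ones matrix (so $p_{ij}+p_{ji}=1$ and $p_{ii}=\frac12$). A matrix $P\in\mathcal{M}_n$ is doubly monotonic if $p_{ij}$ is (weakly) decreasing in $i$ and (weakly) increasing in $j$; $\mathcal{D}_n$ is the set of doubly monotonic $P\in\mathcal{M}_n$. Let $\mathcal{P}_n$ be the set of probability vectors in $\mathbb{R}^n$. An $n$-player tournament $\boldsymbol{T}$ is a set of rules (a randomized algorithm) which, one match at a time, announces an unordered pair $\{i,j\}$ of distinct players who then play a match, receives as only information which of the two won (no draws), and eventually announces one of the $n$ players as tournament winner. The choice of the next pair, and of the winner, may depend on the results of earlier matches and on additional randomness. The number of matches is bounded by a constant depending only on $\boldsymbol{T}$. For $P\in\mathcal{M}_n$, the specialization $(\boldsymbol{T},P)$ is the random process in which every match between $i$ and $j$ is won by $i$ with probability $p_{ij}$, independently of the past; $\pi_i(P)$ is the probability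 that player $i$ wins the tournament, and $\boldsymbol{wv}(\boldsymbol{T},P)=(\pi_1(P),\dots,\pi_n(P))$. Symmetric tournament: for every $P\in\mathcal{M}_n$, every permutation $\sigma$ of $[n]$ and every $i\in[n]$, $\pi_i(P)=\pi_{\sigma(i)}(Q)$, where $Q\in\mathcal{M}_n$ is defined by $q_{\sigma(i)\sigma(j)}=p_{ij}$. Honest tournament: for every possible state of $\boldsymbol{T}$ in which $r\ge0$ matches have been played and a pair $\{i,j\}$ has just been announced for match $r+1$ (the state includes the results of the previous matches and all random choices already made by the rules), and every $P\in\mathcal{M}_n$, one has $\pi_i^+(P)\ge\pi_i^-(P)$, where $\pi_i^+(P)$ (resp. $\pi_i^-(P)$) is the probability that $i$ wins the tournament conditioned on the current state and on $i$ winning (resp. losing) match $r+1$, with all subsequent matches decided according to $P$. An $n$-player tournament map is a continuous function $f=(f_1,\dots,f_n):\mathcal{M}_n\to\mathcal{P}_n$. It is symmetric if $f_i(P)=f_{\sigma(i)}(Q)$ for all $P\in\mathcal{M}_n$, permutations $\sigma$ of $[n]$ and $i\in[n]$, with $Q$ defined by $q_{\sigma(i)\sigma(j)}=p_{ij}$. It is honest if for any distinct $i,j\in[n]$, $f_i(P)$ is (weakly) increasing in $p_{ij}$ (when $p_{ij}$ is increased, $p_{ji}=1-p_{ij}$ is changed accordingly and all other entries are kept fixed). *)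

theory Defs
  imports "HOL-Analysis.Analysis" "HOL-Probability.Probability"
begin

text \<open>
  The set of players $[n]$ is modelled by the elements of an arbitrary type
  \<^typ>\<open>'n\<close> of class \<^class>\<open>finite\<close> and \<^class>\<open>linorder\<close>, so $n$ is the cardinality of the
  type; the linear order is used only in the definition of double monotonicity.
\<close>

definition matrices :: "(real ^ 'n::finite ^ 'n) set" where
  "matrices = {P. (\<forall>i j. 0 \<le> P $ i $ j \<and> P $ i $ j \<le> 1) \<and> P + transpose P = (\<chi> i j. 1)}"

definition doubly_monotonic :: "(real ^ 'n::{finite,linorder} ^ 'n::{finite,linorder}) set" where
  "doubly_monotonic = {P \<in> matrices.
     (\<forall>j. antimono (\<lambda>i. P $ i $ j)) \<and> (\<forall>i. mono (\<lambda>j. P $ i $ j))}"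

definition prob_vectors :: "(real ^ 'n::finite) set" where
  "prob_vectors = {v. (\<forall>i. 0 \<le> v $ i) \<and> (\<Sum>i\<in>UNIV. v $ i) = 1}"

text \<open>
  A tournament is given by its decision tree. In \<open>Play i j S T\<close> the pair $\{i,j\}$ is
  announced; the rules continue with \<open>S\<close> if \<open>i\<close> wins the match and with \<open>T\<close> if \<open>j\<close> wins.
  In \<open>Chance M F\<close> the rules make a random choice \<open>u\<close> in the probability space \<open>M\<close> and continue
  with \<open>F u\<close>. A node of the tree is a state of the tournament: the path leading to it
  records all earlier results and random choices, and the subtree at the node is what remains to
  be played.
\<close>

datatype 'n tournament =
    Winner 'n
  | Play 'n 'n "'n tournament" "'n tournament"
  | Chance "real measure" "real \<Rightarrow> 'n tournament"

primrec states :: "'n tournament \<Rightarrow> 'n tournament set" where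
  "states (Winner w) = {Winner w}"
| "states (Play i j S T) = insert (Play i j S T) (states S \<union> states T)"
| "states (Chance M F) = insert (Chance M F) (\<Union>u\<in>space M. states (F u))"

primrec at_most_matches :: "'n tournament \<Rightarrow> nat \<Rightarrow> bool" where
  "at_most_matches (Winner w) r \<longleftrightarrow> True"
| "at_most_matches (Play i j S T) r \<longleftrightarrow>
     0 < r \<and> at_most_matches S (r - 1) \<and> at_most_matches T (r - 1)"
| "at_most_matches (Chance M F) r \<longleftrightarrow> (\<forall>u\<in>space M. at_most_matches (F u) r)"

text \<open>
  \<open>win_prob T P k\<close> is the probability that \<open>k\<close> is the announced winner. As matches are
  independent of the past, for a state \<open>T\<close> of a larger tournament this is also
  the probability that \<open>k\<close> wins conditioned on the current state.
\<close>

primrec win_prob :: "'n::finite tournament \<Rightarrow> real ^ 'n ^ 'n \<Rightarrow> 'n \<Rightarrow> real" where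
  "win_prob (Winner w) P k = (if k = w then 1 else 0)"
| "win_prob (Play i j S T) P k = P $ i $ j * win_prob S P k + P $ j $ i * win_prob T P k"
| "win_prob (Chance M F) P k = (\<integral>u. win_prob (F u) P k \<partial>M)"

definition win_vector :: "'n::finite tournament \<Rightarrow> real ^ 'n ^ 'n \<Rightarrow> real ^ 'n" where
  "win_vector T P = (\<chi> k. win_prob T P k)"

text \<open>
  Measurability at the chance nodes guarantees that the Bochner integrals
  defining \<^const>\<open>win_prob\<close> are genuine expectations.
\<close>

definition is_tournament :: "'n::finite tournament \<Rightarrow> bool" where
  "is_tournament T \<longleftrightarrow>
     (\<forall>i j A B. Play i j A B \<in> states T \<longrightarrow> i \<noteq> j) \<and>
     (\<forall>M F. Chance M F \<in> states T \<longrightarrow> prob_space M \<and>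
        (\<forall>P\<in>matrices. \<forall>k. (\<lambda>u. win_prob (F u) P k) \<in> borel_measurable M)) \<and>
     (\<exists>r. at_most_matches T r)"

definition symmetric_map :: "(real ^ 'n::finite ^ 'n \<Rightarrow> real ^ 'n) \<Rightarrow> bool" where
  "symmetric_map f \<longleftrightarrow>
     (\<forall>P\<in>matrices. \<forall>Q\<in>matrices. \<forall>\<sigma>. bij \<sigma> \<longrightarrow> (\<forall>i j. Q $ \<sigma> i $ \<sigma> j = P $ i $ j) \<longrightarrow>
        (\<forall>i. f P $ i = f Q $ \<sigma> i))"

definition symmetric_tournament :: "'n::finite tournament \<Rightarrow> bool" where
  "symmetric_tournament T \<longleftrightarrow> symmetric_map (win_vector T)"

text \<open>
  The announced pair is unordered, so the condition is imposed on both of its players.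
\<close>

definition honest_tournament :: "'n::finite tournament \<Rightarrow> bool" where
  "honest_tournament T \<longleftrightarrow>
     (\<forall>i j A B. Play i j A B \<in> states T \<longrightarrow>
        (\<forall>P\<in>matrices. win_prob A P i \<ge> win_prob B P i \<and> win_prob B P j \<ge> win_prob A P j))"

text \<open>Only the values of a tournament map on \<^const>\<open>matrices\<close> are relevant.\<close>

definition tournament_map :: "(real ^ 'n::finite ^ 'n \<Rightarrow> real ^ 'n) \<Rightarrow> bool" where
  "tournament_map f \<longleftrightarrow> continuous_on matrices f \<and> f ` matrices \<subseteq> prob_vectors"

definition honest_map :: "(real ^ 'n::finite ^ 'n \<Rightarrow> real ^ 'n) \<Rightarrow> bool" where
  "honest_map f \<longleftrightarrow>
     (\<forall>i j. i \<noteq> j \<longrightarrow> (\<forall>P\<in>matrices. \<forall>Q\<in>matrices.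
        (\<forall>k l. {k, l} \<noteq> {i, j} \<longrightarrow> Q $ k $ l = P $ k $ l) \<longrightarrow>
        P $ i $ j \<le> Q $ i $ j \<longrightarrow> f P $ i \<le> f Q $ i))"

definition map_win_vectors :: "(real ^ 'n::{finite,linorder}) set" where
  "map_win_vectors =
     {f P | f P. tournament_map f \<and> symmetric_map f \<and> honest_map f \<and> P \<in> doubly_monotonic}"

definition tournament_win_vectors :: "(real ^ 'n::{finite,linorder}) set" where
  "tournament_win_vectors =
     closure {win_vector T P | T P. is_tournament T \<and> symmetric_tournament T \<and>
                honest_tournament T \<and> P \<in> doubly_monotonic}"

end

theory Submission imports Defs begin

text \<open>
  Only the order type of the entries of $P \in \mathcal{D}_n$ matters: precomposing a map entrywise
  with an increasing function \<open>\<phi>\<close> with \<open>\<phi> (1 - x) = 1 - \<phi> x\<close> preserves symmetry and honesty, so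
  $P$ may be moved to a fixed finite grid. On the grid, symmetry and honesty are finitely many linear
  conditions, and the possible values at a grid point form the projection of a polytope. Conversely, a
  solution on the grid extends to a continuous map by averaging it over a random entrywise rounding to
  the grid. Hence \<open>A\<^sub>n\<close> is a finite union of polytopes, in particular closed, and it contains all win
  vectors because the win vector of a symmetric and honest tournament is itself such a map.
  For the other inclusion, play every pair many times, estimate \<open>P\<close> by the observed
  frequencies, and draw the winner from \<open>f\<close> of the estimate. By the weak law of large numbers the win
  vector is close to \<open>f P\<close>.
\<close>

section \<open>Fair maps on a set of matrices, and analytic preliminaries\<close>

text \<open>Continuity is left out and all quantifiers are relativized to \<open>S\<close>, so that
  the same conditions make sense on \<open>matrices\<close> and on the finite grid, where they are
  finitely many linear constraints on the values of \<open>f\<close>.\<close>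

definition fair_on :: "(real ^ 'n::finite ^ 'n) set \<Rightarrow> (real ^ 'n ^ 'n \<Rightarrow> real ^ 'n) \<Rightarrow> bool" where
  "fair_on S f \<longleftrightarrow>
     (\<forall>P\<in>S. f P \<in> prob_vectors) \<and>
     (\<forall>P\<in>S. \<forall>Q\<in>S. \<forall>\<sigma>. bij \<sigma> \<longrightarrow> (\<forall>i j. Q $ \<sigma> i $ \<sigma> j = P $ i $ j) \<longrightarrow>
        (\<forall>i. f P $ i = f Q $ \<sigma> i)) \<and>
     (\<forall>i j. i \<noteq> j \<longrightarrow> (\<forall>P\<in>S. \<forall>Q\<in>S.
        (\<forall>k l. {k, l} \<noteq> {i, j} \<longrightarrow> Q $ k $ l = P $ k $ l) \<longrightarrow>
        P $ i $ j \<le> Q $ i $ j \<longrightarrow> f P $ i \<le> f Q $ i))"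

lemma fair_on_matrices_iff:
  "tournament_map f \<and> symmetric_map f \<and> honest_map f \<longleftrightarrow>
     continuous_on matrices f \<and> fair_on matrices f"
  by (auto simp: fair_on_def tournament_map_def symmetric_map_def honest_map_def)

lemma fair_on_prob: "fair_on S f \<Longrightarrow> P \<in> S \<Longrightarrow> f P \<in> prob_vectors"
  by (simp add: fair_on_def)

lemma fair_on_symmetric:
  assumes "fair_on S f" "P \<in> S" "Q \<in> S" "bij \<sigma>" "\<And>i j. Q $ \<sigma> i $ \<sigma> j = P $ i $ j"
  shows "f P $ i = f Q $ \<sigma> i"
  using assms unfolding fair_on_def by blast

lemma fair_on_honest:
  assumes "fair_on S f" "i \<noteq> j" "P \<in> S" "Q \<in> S"
    "\<And>k l. {k, l} \<noteq> {i, j} \<Longrightarrow> Q $ k $ l = P $ k $ l" "P $ i $ j \<le> Q $ i $ j"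
  shows "f P $ i \<le> f Q $ i"
  using assms unfolding fair_on_def by blast

lemma matrices_iff: "P \<in> matrices \<longleftrightarrow> (\<forall>i j. 0 \<le> P $ i $ j \<and> P $ i $ j + P $ j $ i = 1)"
  unfolding matrices_def
  by (auto simp: vec_eq_iff transpose_def) (metis add.commute add_increasing2 add_le_cancel_left add.right_neutral)

lemma matrices_entry:
  assumes "P \<in> matrices"
  shows "0 \<le> P $ i $ j" "P $ i $ j \<le> 1" "P $ j $ i = 1 - P $ i $ j"
  using assms by (auto simp: matrices_def matrices_iff[of P] algebra_simps)
    (metis add_diff_cancel_left' assms matrices_iff)

lemma prob_vectors_le_1: "v \<in> prob_vectors \<Longrightarrow> v $ i \<le> 1"
  unfolding prob_vectors_def
  by (auto, metis (mono_tags) finite_class.finite_UNIV UNIV_I member_le_sum)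

text \<open>Dominated convergence along sequences, with the constant \<open>B\<close> as majorant.
  The exceptional null set may depend on the point, which is what permits averaging over
  discontinuous roundings.\<close>

lemma continuous_on_integral_bounded:
  fixes h :: "'a::{first_countable_topology, t2_space} \<Rightarrow> 'b \<Rightarrow> real"
  assumes "prob_space M"
    and meas: "\<And>x. x \<in> S \<Longrightarrow> h x \<in> borel_measurable M"
    and bd: "\<And>x u. x \<in> S \<Longrightarrow> u \<in> space M \<Longrightarrow> \<bar>h x u\<bar> \<le> B"
    and cont: "\<And>x. x \<in> S \<Longrightarrow> AE u in M. continuous (at x within S) (\<lambda>y. h y u)"
  shows "continuous_on S (\<lambda>x. \<integral>u. h x u \<partial>M)"
  unfolding continuous_on_sequentially
proof (intro allI ballI impI, elim conjE)
  interpret prob_space M by fact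
  fix X a assume a: "a \<in> S" and X: "\<forall>n. X n \<in> S" "X \<longlonglongrightarrow> a"
  show "((\<lambda>x. \<integral>u. h x u \<partial>M) \<circ> X) \<longlonglongrightarrow> (\<integral>u. h a u \<partial>M)"
    unfolding o_def
  proof (rule integral_dominated_convergence[where w = "\<lambda>_. B"])
    show "AE u in M. (\<lambda>i. h (X i) u) \<longlonglongrightarrow> h a u"
      using cont[OF a] by eventually_elim (rule continuous_within_tendsto_compose'[OF _ _ X(2)], use X in auto)
  qed (use meas a X bd in auto)
qed

lemma integrable_bounded_prob:
  assumes "prob_space M" "g \<in> borel_measurable M" "\<And>u. u \<in> space M \<Longrightarrow> \<bar>g u\<bar> \<le> (B::real)"
  shows "integrable M g"
proof -
  interpret prob_space M by fact
  show ?thesis by (rule integrable_const_bound[where B = B]) (use assms in auto)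
qed

subsection \<open>Win vectors as tournament maps\<close>

lemma is_tournament_Play: "is_tournament (Play i j A B) \<Longrightarrow> is_tournament A \<and> is_tournament B \<and> i \<noteq> j"
  unfolding is_tournament_def by fastforce

lemma states_Chance: "u \<in> space M \<Longrightarrow> states (F u) \<subseteq> states (Chance M F)"
  by auto

lemma is_tournament_Chance:
  assumes "is_tournament (Chance M F)"
  shows "prob_space M \<and> (\<forall>u\<in>space M. is_tournament (F u)) \<and>
     (\<forall>P\<in>matrices. \<forall>k. (\<lambda>u. win_prob (F u) P k) \<in> borel_measurable M)"
proof -
  have "Chance M F \<in> states (Chance M F)" by simp
  then have "prob_space M" "\<forall>P\<in>matrices. \<forall>k. (\<lambda>u. win_prob (F u) P k) \<in> borel_measurable M"
    using assms unfolding is_tournament_def by blast+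
  moreover have "is_tournament (F u)" if u: "u \<in> space M" for u
  proof -
    obtain r where "at_most_matches (Chance M F) r" using assms unfolding is_tournament_def by blast
    then have "at_most_matches (F u) r" using u by simp
    then show ?thesis
      using assms states_Chance[OF u, of F] unfolding is_tournament_def by blast
  qed
  ultimately show ?thesis by blast
qed

lemma win_prob_prob_vector:
  "is_tournament T \<Longrightarrow> P \<in> matrices \<Longrightarrow> win_vector T P \<in> prob_vectors"
proof (induction T)
  case (Winner w)
  then show ?case by (auto simp: win_vector_def prob_vectors_def)
next
  case (Play i j A B)
  have "win_vector A P \<in> prob_vectors" "win_vector B P \<in> prob_vectors"
    using Play is_tournament_Play by blast+
  then show ?case
    using matrices_entry[OF Play.prems(2), of i j]
    by (auto simp: win_vector_def prob_vectors_def sum.distrib sum_distrib_left[symmetric])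
next
  case (Chance M F)
  note * = is_tournament_Chance[OF Chance.prems(1)]
  interpret prob_space M using * by blast
  have v: "win_vector (F u) P \<in> prob_vectors" if "u \<in> space M" for u
    using Chance * that by blast
  have m: "integrable M (\<lambda>u. win_prob (F u) P k)" for k
    using prob_vectors_le_1[OF v, of _ k] v * Chance.prems(2)
    by (intro integrable_bounded_prob[where B = 1] prob_space_axioms)
       (auto simp: prob_vectors_def win_vector_def)
  have "(\<Sum>k\<in>UNIV. \<integral>u. win_prob (F u) P k \<partial>M) = (\<integral>u. (\<Sum>k\<in>UNIV. win_prob (F u) P k) \<partial>M)"
    using m by (subst Bochner_Integration.integral_sum) auto
  also have "\<dots> = (\<integral>u. 1 \<partial>M)"
    using v by (intro Bochner_Integration.integral_cong) (auto simp: prob_vectors_def win_vector_def)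
  finally show ?case
    using v by (auto simp: win_vector_def prob_vectors_def prob_space intro!: Bochner_Integration.integral_nonneg)
qed

lemma win_prob_bounds:
  assumes "is_tournament T" "P \<in> matrices"
  shows "0 \<le> win_prob T P k" "win_prob T P k \<le> 1"
  using win_prob_prob_vector[OF assms] prob_vectors_le_1[OF win_prob_prob_vector[OF assms], of k]
  by (auto simp: prob_vectors_def win_vector_def)

text \<open>A match node only adds and multiplies continuous functions, and at a chance node the
  bound 1 on winning probabilities allows dominated convergence.\<close>

lemma continuous_on_win_prob:
  "is_tournament T \<Longrightarrow> continuous_on matrices (\<lambda>P. win_prob T P k)"
proof (induction T)
  case (Winner w)
  then show ?case by simp
next
  case (Play i j A B)
  have "continuous_on matrices (\<lambda>P. win_prob A P k)" "continuous_on matrices (\<lambda>P. win_prob B P k)"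
    using Play is_tournament_Play by blast+
  then show ?case by (auto intro!: continuous_intros)
next
  case (Chance M F)
  note * = is_tournament_Chance[OF Chance.prems]
  have "continuous_on matrices (\<lambda>P. \<integral>u. win_prob (F u) P k \<partial>M)"
  proof (rule continuous_on_integral_bounded[where B = 1])
    show "AE u in M. continuous (at P within matrices) (\<lambda>Q. win_prob (F u) Q k)" if "P \<in> matrices" for P
      using Chance.IH * that unfolding continuous_on_eq_continuous_within by (intro AE_I2) blast
    show "\<bar>win_prob (F u) P k\<bar> \<le> 1" if "P \<in> matrices" "u \<in> space M" for P u
      using win_prob_bounds[of "F u" P k] * that by auto
  qed (use * in auto)
  then show ?case by simp
qed

lemma honest_tournament_Play:
  "honest_tournament (Play i j A B) \<Longrightarrow> honest_tournament A \<and> honest_tournament B"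
  unfolding honest_tournament_def by fastforce

lemma honest_tournament_Chance:
  "honest_tournament (Chance M F) \<Longrightarrow> u \<in> space M \<Longrightarrow> honest_tournament (F u)"
  using states_Chance[of u M F] unfolding honest_tournament_def by blast

lemma honest_match:
  assumes "honest_tournament (Play i j A B)" "P \<in> matrices"
  shows "win_prob B P i \<le> win_prob A P i" "win_prob A P j \<le> win_prob B P j"
  using assms unfolding honest_tournament_def by auto

text \<open>At each match, \<open>P\<close> is replaced by \<open>Q\<close> in two steps: first in
  the subtrees, by induction, then in the weights of the match itself. The weights change only if
  \<open>i\<close> and \<open>j\<close> meet, and there honesty at \<open>Q\<close> makes the change
  favourable to \<open>i\<close>.\<close>

lemma win_prob_mono:
  assumes "i \<noteq> j" "P \<in> matrices" "Q \<in> matrices"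
    "\<And>k l. {k, l} \<noteq> {i, j} \<Longrightarrow> Q $ k $ l = P $ k $ l" "P $ i $ j \<le> Q $ i $ j"
  shows "is_tournament T \<Longrightarrow> honest_tournament T \<Longrightarrow> win_prob T P i \<le> win_prob T Q i"
proof (induction T)
  case (Winner w)
  then show ?case by simp
next
  case (Play a b A B)
  have IH: "win_prob A P i \<le> win_prob A Q i" "win_prob B P i \<le> win_prob B Q i"
    using Play is_tournament_Play honest_tournament_Play by blast+
  have pq: "P $ a $ b \<ge> 0" "P $ b $ a = 1 - P $ a $ b" "P $ a $ b \<le> 1" "Q $ b $ a = 1 - Q $ a $ b"
    using matrices_entry[OF assms(2), of a b] matrices_entry[OF assms(3), of a b] by auto
  have "win_prob (Play a b A B) P i \<le> P $ a $ b * win_prob A Q i + P $ b $ a * win_prob B Q i"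
    using IH pq by (auto intro!: add_mono mult_left_mono)
  \<comment> \<open>Isolating the gain from the first outcome leaves a single coefficient to
    compare; if \<open>i\<close> and \<open>j\<close> meet, honesty gives the sign of the
    gain.\<close>
  also have "\<dots> = P $ a $ b * (win_prob A Q i - win_prob B Q i) + win_prob B Q i"
    unfolding pq(2) by (simp add: algebra_simps)
  also have "P $ a $ b * (win_prob A Q i - win_prob B Q i)
      \<le> Q $ a $ b * (win_prob A Q i - win_prob B Q i)"
  proof (cases "{a, b} = {i, j}")
    case False
    then show ?thesis using assms(4) by simp
  next
    case True
    then consider "a = i" "b = j" | "a = j" "b = i" by (auto simp: doubleton_eq_iff)
    then show ?thesis
    proof cases
      case 1
      then show ?thesis
        using honest_match(1)[OF Play.prems(2) assms(3)] assms(5) by (auto intro!: mult_right_mono)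
    next
      \<comment> \<open>The pair is listed as \<open>j\<close>, \<open>i\<close>: the coefficient
        falls, but the difference it multiplies is nonpositive.\<close>
      case 2
      then have "Q $ a $ b \<le> P $ a $ b"
        using assms(5) matrices_entry(3)[OF assms(2), of j i] matrices_entry(3)[OF assms(3), of j i] by simp
      then show ?thesis
        using honest_match(2)[OF Play.prems(2) assms(3)] 2 by (auto intro!: mult_right_mono_neg)
    qed
  qed
  also have "Q $ a $ b * (win_prob A Q i - win_prob B Q i) + win_prob B Q i = win_prob (Play a b A B) Q i"
    by (simp add: pq(4) algebra_simps)
  finally show ?case by simp
next
  case (Chance M F)
  note * = is_tournament_Chance[OF Chance.prems(1)]
  have int: "integrable M (\<lambda>u. win_prob (F u) R i)" if "R \<in> matrices" for R
    using win_prob_bounds[of "F _" R i] * that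
    by (intro integrable_bounded_prob[where B = 1]) auto
  show ?case
    using Chance.IH * honest_tournament_Chance[OF Chance.prems(2)] assms(2,3)
    by (auto intro!: integral_mono int)
qed

lemma fair_win_vector:
  assumes "is_tournament T" "symmetric_tournament T" "honest_tournament T"
  shows "tournament_map (win_vector T) \<and> symmetric_map (win_vector T) \<and> honest_map (win_vector T)"
proof (intro conjI)
  show "tournament_map (win_vector T)"
    unfolding tournament_map_def
    using assms(1) win_prob_prob_vector
    by (auto simp: win_vector_def[abs_def] intro!: continuous_on_vec_lambda continuous_on_win_prob)
  show "honest_map (win_vector T)"
    unfolding honest_map_def using win_prob_mono[OF _ _ _ _ _ assms(1,3)] by (simp add: win_vector_def)
qed (use assms in \<open>simp add: symmetric_tournament_def\<close>)

subsection \<open>Restriction to a finite grid\<close>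

definition map_entries :: "(real \<Rightarrow> real) \<Rightarrow> real ^ 'n::finite ^ 'n \<Rightarrow> real ^ 'n ^ 'n" where
  "map_entries \<phi> P = (\<chi> i j. \<phi> (P $ i $ j))"

lemma map_entries_nth [simp]: "map_entries \<phi> P $ i $ j = \<phi> (P $ i $ j)"
  by (simp add: map_entries_def)

text \<open>An entrywise function commutes with relabelling the players, and a monotone one
  preserves the comparison of entries in the honesty condition. This serves both to pull maps back
  to the grid and to extend them from it.\<close>

lemma fair_on_map_entries:
  assumes g: "fair_on S g" and S': "S' \<subseteq> matrices"
    and map: "\<And>P. P \<in> S' \<Longrightarrow> map_entries \<phi> P \<in> S"
    and mono: "mono_on {0..1} \<phi>"
  shows "fair_on S' (\<lambda>P. g (map_entries \<phi> P))"
  unfolding fair_on_def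
proof (intro conjI allI ballI impI)
  fix P assume "P \<in> S'"
  then show "g (map_entries \<phi> P) \<in> prob_vectors" using g map fair_on_prob by blast
next
  fix P Q \<sigma> i assume "P \<in> S'" "Q \<in> S'" "bij \<sigma>" "\<forall>i j. Q $ \<sigma> i $ \<sigma> j = P $ i $ j"
  then show "g (map_entries \<phi> P) $ i = g (map_entries \<phi> Q) $ \<sigma> i"
    by (intro fair_on_symmetric[OF g]) (auto intro: map)
next
  fix i j P Q assume *: "i \<noteq> j" "P \<in> S'" "Q \<in> S'" "\<forall>k l. {k, l} \<noteq> {i, j} \<longrightarrow> Q $ k $ l = P $ k $ l"
    "P $ i $ j \<le> Q $ i $ j"
  have "\<phi> (P $ i $ j) \<le> \<phi> (Q $ i $ j)"
    using * S' matrices_entry(1,2)[of P i j] matrices_entry(1,2)[of Q i j]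
    by (intro mono_onD[OF mono]) auto
  then show "g (map_entries \<phi> P) $ i \<le> g (map_entries \<phi> Q) $ i"
    using * by (intro fair_on_honest[OF g \<open>i \<noteq> j\<close>]) (auto intro: map)
qed

section \<open>Polyhedra given by linear conditions\<close>

lemma polyhedron_linear_le:
  fixes l :: "'a::euclidean_space \<Rightarrow> real"
  assumes "linear l"
  shows "polyhedron {x. l x \<le> c}"
proof -
  have "{x. l x \<le> c} = {x. adjoint l 1 \<bullet> x \<le> c}"
    using adjoint_works[OF assms, of _ 1] by (simp add: inner_commute)
  then show ?thesis by (simp add: polyhedron_halfspace_le)
qed

lemma polyhedron_linear_eq:
  fixes l :: "'a::euclidean_space \<Rightarrow> real"
  assumes "linear l"
  shows "polyhedron {x. l x = c}"
proof -
  have "{x. l x = c} = {x. adjoint l 1 \<bullet> x = c}"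
    using adjoint_works[OF assms, of _ 1] by (simp add: inner_commute)
  then show ?thesis by (simp add: polyhedron_hyperplane)
qed

text \<open>Finite conjunctions are finite intersections. Together with the next three rules this
  lets a condition such as \<open>fair_on\<close> be split along its logical connectives.\<close>

lemma polyhedron_ball:
  assumes "finite A" "\<And>a. a \<in> A \<Longrightarrow> polyhedron {x. R a x}"
  shows "polyhedron {x. \<forall>a\<in>A. R a x}"
proof -
  have "{x. \<forall>a\<in>A. R a x} = \<Inter>((\<lambda>a. {x. R a x}) ` A)" by auto
  then show ?thesis using assms by auto
qed

lemma polyhedron_all:
  assumes "\<And>a::'b::finite. polyhedron {x. R a x}"
  shows "polyhedron {x. \<forall>a. R a x}"
  using polyhedron_ball[of UNIV R] assms by simp

text \<open>\<open>c\<close> is independent of \<open>x\<close>, so the set is either the whole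
  space or the one cut out by \<open>R\<close>.\<close>

lemma polyhedron_imp:
  assumes "c \<Longrightarrow> polyhedron {x. R x}"
  shows "polyhedron {x. c \<longrightarrow> R x}"
  using assms by (cases c) auto

lemma polyhedron_conj:
  assumes "polyhedron {x. R x}" "polyhedron {x. R' x}"
  shows "polyhedron {x. R x \<and> R' x}"
  using polyhedron_Int[OF assms] by (simp add: Collect_conj_eq)

lemma linear_nth_nth: "linear (\<lambda>g :: real ^ 'n::finite ^ 'm::finite. g $ a $ i)"
  by (rule linearI) auto

lemma polyhedron_prob_vectors: "polyhedron {g :: real ^ 'n::finite ^ 'm::finite. g $ a \<in> prob_vectors}"
  unfolding prob_vectors_def mem_Collect_eq
proof (intro polyhedron_conj polyhedron_all)
  show "polyhedron {g :: real ^ 'n ^ 'm. 0 \<le> g $ a $ i}" for i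
    using polyhedron_linear_le[OF linear_compose_neg[OF linear_nth_nth[of a i]], of 0] by simp
  show "polyhedron {g :: real ^ 'n ^ 'm. (\<Sum>i\<in>UNIV. g $ a $ i) = 1}"
    by (intro polyhedron_linear_eq linear_compose_sum ballI linear_nth_nth)
qed

text \<open>
  A map on \<open>S\<close> becomes a point of a Euclidean space through an injection of \<open>S\<close> into a finite index type.
\<close>

lemma polytope_fair_values:
  fixes S :: "(real ^ 'n::finite ^ 'n) set" and enc :: "real ^ 'n ^ 'n \<Rightarrow> 'i::finite"
  assumes "inj_on enc S" and P: "P \<in> S"
  shows "polytope {g P | g. fair_on S g}"
proof -
  \<comment> \<open>Every coordinate must be a probability vector, also those outside the image of
    \<open>S\<close> under \<open>enc\<close>; this bounds \<open>K\<close>.\<close>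
  define K where "K = {g :: real ^ 'n ^ 'i. (\<forall>a. g $ a \<in> prob_vectors) \<and> fair_on S (\<lambda>P. g $ enc P)}"
  have fin: "finite S" by (rule finite_imageD[OF _ assms(1)]) simp
  have "polyhedron K"
    unfolding K_def fair_on_def
  proof (intro polyhedron_conj polyhedron_all polyhedron_imp polyhedron_ball fin polyhedron_prob_vectors)
    show "polyhedron {g :: real ^ 'n ^ 'i. g $ enc P $ i = g $ enc Q $ j}" for P Q i j
      using polyhedron_linear_eq[OF linear_compose_sub[OF linear_nth_nth[of "enc P" i] linear_nth_nth[of "enc Q" j]], of 0]
      by simp
    show "polyhedron {g :: real ^ 'n ^ 'i. g $ enc P $ i \<le> g $ enc Q $ j}" for P Q i j
      using polyhedron_linear_le[OF linear_compose_sub[OF linear_nth_nth[of "enc P" i] linear_nth_nth[of "enc Q" j]], of 0]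
      by simp
  qed
  moreover have "bounded K"
  proof (rule boundedI)
    fix g assume "g \<in> K"
    then have g: "g $ a \<in> prob_vectors" for a by (auto simp: K_def)
    have "norm (g $ a) \<le> 1" for a
      using norm_le_l1_cart[of "g $ a"] g[of a] by (auto simp: prob_vectors_def)
    then have "(\<Sum>a\<in>UNIV. norm (g $ a)) \<le> (\<Sum>a\<in>(UNIV :: 'i set). 1)" by (intro sum_mono) auto
    then show "norm g \<le> real CARD('i)"
      using L2_set_le_sum[of UNIV "\<lambda>a. norm (g $ a)"] by (simp add: norm_vec_def)
  qed
  ultimately have "polytope K" by (simp add: polytope_eq_bounded_polyhedron)
  \<comment> \<open>The admissible values at \<open>P\<close> form a coordinate projection of
    \<open>K\<close>.\<close>
  then have "polytope ((\<lambda>g. g $ enc P) ` K)"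
    by (intro polytope_linear_image) (auto intro!: linearI)
  moreover have "(\<lambda>g. g $ enc P) ` K = {g P | g. fair_on S g}"
  proof (intro equalityI subsetI)
    fix v assume "v \<in> {g P | g. fair_on S g}"
    then obtain g where g: "fair_on S g" "v = g P" by blast
    \<comment> \<open>Coordinates outside the image of \<open>S\<close> are filled with
      \<open>g P\<close>, a probability vector at hand.\<close>
    define h :: "real ^ 'n ^ 'i" where
      "h = (\<chi> a. if a \<in> enc ` S then g (inv_into S enc a) else g P)"
    have h: "h $ enc Q = g Q" if "Q \<in> S" for Q
      using that assms(1) by (simp add: h_def)
    have "fair_on S (\<lambda>P. h $ enc P)"
      using g(1) by (simp add: fair_on_def h)
    moreover have "h $ a \<in> prob_vectors" for a
      using fair_on_prob[OF g(1)] P by (auto simp: h_def inv_into_into)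
    ultimately show "v \<in> (\<lambda>g. g $ enc P) ` K"
      using h[OF P] g(2) by (auto simp: K_def image_iff intro!: exI[of _ h])
  qed (auto simp: K_def)
  ultimately show ?thesis by simp
qed

section \<open>The grid, and the passage to it by ranks\<close>

text \<open>For \<open>m > 0\<close> these are the multiples of \<open>1 / (2 * m)\<close> in the
  unit interval. Indexing by the signed distance from \<open>1 / 2\<close> turns
  \<open>x \<mapsto> 1 - x\<close> into \<open>k \<mapsto> - k\<close>.\<close>

definition grid_values :: "nat \<Rightarrow> real set" where
  "grid_values m = (\<lambda>k. 1 / 2 + of_int k / (2 * real m)) ` {- int m..int m}"

definition grid :: "nat \<Rightarrow> (real ^ 'n::finite ^ 'n) set" where
  "grid m = {P \<in> matrices. \<forall>i j. P $ i $ j \<in> grid_values m}"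

lemma finite_grid_values: "finite (grid_values m)" "card (grid_values m) \<le> 2 * m + 1"
proof -
  show "card (grid_values m) \<le> 2 * m + 1"
    unfolding grid_values_def by (rule order_trans[OF card_image_le]) auto
qed (simp add: grid_values_def)

text \<open>Provides the finite index type for \<open>polytope_fair_values\<close>, by encoding each
  entry separately.\<close>

lemma ex_grid_encoding:
  assumes "2 * m + 1 \<le> CARD('k::finite)"
  shows "\<exists>enc :: real ^ 'n::finite ^ 'n \<Rightarrow> ('n \<Rightarrow> 'n \<Rightarrow> 'k). inj_on enc (grid m)"
proof -
  have "card (grid_values m) \<le> CARD('k)" using finite_grid_values(2)[of m] assms by simp
  then obtain e :: "real \<Rightarrow> 'k" where e: "inj_on e (grid_values m)"
    using card_le_inj[of "grid_values m" "UNIV :: 'k set"] finite_grid_values(1) by auto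
  have "inj_on (\<lambda>P :: real ^ 'n ^ 'n. \<lambda>i j. e (P $ i $ j)) (grid m)"
  proof (rule inj_onI)
    fix P Q :: "real ^ 'n ^ 'n"
    assume "P \<in> grid m" "Q \<in> grid m" "(\<lambda>i j. e (P $ i $ j)) = (\<lambda>i j. e (Q $ i $ j))"
    then have "P $ i $ j = Q $ i $ j" for i j
      using e by (auto simp: grid_def inj_on_def fun_eq_iff)
    then show "P = Q" by (simp add: vec_eq_iff)
  qed
  then show ?thesis by blast
qed

text \<open>\<open>P\<close> has at most \<open>CARD('n) ^ 2\<close> distinct entries, few enough to
  be placed on the grid in the same order by \<open>\<rho>\<close>. A monotone \<open>\<phi>\<close>
  that undoes this placement turns \<open>f\<close> into a fair map on the grid with value
  \<open>f P\<close> at the image of \<open>P\<close>.\<close>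

lemma fair_value_on_grid:
  fixes P :: "real ^ 'n::{finite,linorder} ^ 'n::{finite,linorder}"
  assumes f: "fair_on matrices f" and P: "P \<in> doubly_monotonic" and m: "CARD('n) ^ 2 \<le> m"
  shows "\<exists>P' g. P' \<in> doubly_monotonic \<inter> grid m \<and> fair_on (grid m) g \<and> g P' = f P"
proof -
  have PM: "P \<in> matrices" using P by (simp add: doubly_monotonic_def)
  have m0: "0 < m" using m by (metis less_le_trans zero_less_card_finite zero_less_power)
  define V where "V = range (\<lambda>(i, j). P $ i $ j)"
  have V: "finite V" "P $ i $ j \<in> V" for i j
    by (auto simp: V_def intro: range_eqI[of _ _ "(i, j)"])
  have "card V \<le> CARD('n \<times> 'n)" unfolding V_def by (rule card_image_le) simp
  then have cardV: "card V \<le> m" using m by (simp add: power2_eq_square)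
  have V01: "0 \<le> p \<and> p \<le> 1 \<and> 1 - p \<in> V" if p: "p \<in> V" for p
  proof -
    obtain i j where ij: "p = P $ i $ j" using p by (auto simp: V_def)
    then have "1 - p = P $ j $ i" using matrices_entry(3)[OF PM, of i j] by simp
    then show ?thesis using V(2)[of j i] matrices_entry(1,2)[OF PM, of i j] ij by simp
  qed
  \<comment> \<open>\<open>\<rho>\<close> is a symmetrized rank, and \<open>\<phi>\<close> below is a monotone left inverse of it on \<open>V\<close>.\<close>
  define r where "r p = int (card {w \<in> V. w < p}) - int (card {w \<in> V. p < w})" for p
  define \<rho> where "\<rho> p = 1 / 2 + real_of_int (r p) / (2 * real m)" for p
  have "r p \<le> r q" if "p \<le> q" for p q
    using card_mono[of "{w \<in> V. w < q}" "{w \<in> V. w < p}"] card_mono[of "{w \<in> V. p < w}" "{w \<in> V. q < w}"]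
      that V(1) unfolding r_def by fastforce
  then have \<rho>_mono: "mono \<rho>"
    using m0 by (auto intro!: monoI simp: \<rho>_def divide_right_mono)
  \<comment> \<open>Strictness comes from \<open>p\<close> itself, which is counted below
    \<open>q\<close> but not below \<open>p\<close>.\<close>
  have "r p < r q" if "p < q" "p \<in> V" for p q
    using psubset_card_mono[of "{w \<in> V. w < q}" "{w \<in> V. w < p}"] card_mono[of "{w \<in> V. p < w}" "{w \<in> V. q < w}"]
      that V(1) unfolding r_def by fastforce
  then have \<rho>_less: "\<rho> p < \<rho> q" if "p < q" "p \<in> V" for p q
    using m0 that by (simp add: \<rho>_def divide_strict_right_mono)
  have "card {w \<in> V. w < p} + card {w \<in> V. p < w} \<le> card V" for p
    using V(1) by (subst card_Un_disjoint[symmetric]) (auto intro!: card_mono)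
  then have sum_le: "card {w \<in> V. w < p} + card {w \<in> V. p < w} \<le> m" for p
    using cardV le_trans by blast
  have r_bound: "\<bar>r p\<bar> \<le> int m" for p
  proof -
    have "card {w \<in> V. w < p} \<le> m" "card {w \<in> V. p < w} \<le> m"
      using sum_le[of p] by linarith+
    then show ?thesis unfolding r_def by linarith
  qed
  \<comment> \<open>The reflection \<open>w \<mapsto> 1 - w\<close> permutes \<open>V\<close> and
    exchanges the elements below \<open>p\<close> with those above \<open>1 - p\<close>; hence
    \<open>r\<close> is odd about \<open>1 / 2\<close>.\<close>
  have refl: "card {w \<in> V. R (1 - w)} = card {w \<in> V. R w}" for R
  proof (rule bij_betw_same_card[of "\<lambda>w. 1 - w"])
    show "bij_betw (\<lambda>w. 1 - w) {w \<in> V. R (1 - w)} {w \<in> V. R w}"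
      by (rule bij_betw_byWitness[where f' = "\<lambda>w. 1 - w"]) (use V01 in auto)
  qed
  have "r (1 - p) = - r p" for p
    using refl[of "\<lambda>w. w < p"] refl[of "\<lambda>w. p < w"] unfolding r_def
    by (simp add: less_diff_eq diff_less_eq add.commute)
  then have \<rho>_refl: "\<rho> (1 - p) = 1 - \<rho> p" for p by (simp add: \<rho>_def)
  have \<rho>_grid: "\<rho> p \<in> grid_values m" for p
    using r_bound[of p] unfolding grid_values_def \<rho>_def by (intro imageI) auto
  have \<rho>_nonneg: "0 \<le> \<rho> p" for p
  proof -
    have "- real m \<le> real_of_int (r p)" using r_bound[of p] by linarith
    then show ?thesis using m0 by (simp add: \<rho>_def field_simps)
  qed

  \<comment> \<open>The largest element of \<open>V\<close> whose image under \<open>\<rho>\<close>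
    is at most \<open>x\<close>; the inserted 0 is the value when there is none.\<close>
  define \<phi>0 where "\<phi>0 x = Max (insert 0 {p \<in> V. \<rho> p \<le> x})" for x
  \<comment> \<open>Averaging \<open>\<phi>0\<close> with its reflection yields
    \<open>\<phi> (1 - x) = 1 - \<phi> x\<close>, and keeps monotonicity and the left inverse
    property on \<open>V\<close>.\<close>
  define \<phi> where "\<phi> x = (\<phi>0 x + 1 - \<phi>0 (1 - x)) / 2" for x
  have \<phi>0_mono: "\<phi>0 x \<le> \<phi>0 y" if "x \<le> y" for x y
    unfolding \<phi>0_def using that V(1) by (intro Max_mono) auto
  have \<phi>0_01: "0 \<le> \<phi>0 x \<and> \<phi>0 x \<le> 1" for x
    unfolding \<phi>0_def using V(1) V01 by auto
  have \<phi>0_\<rho>: "\<phi>0 (\<rho> q) = q" if "q \<in> V" for q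
    unfolding \<phi>0_def
  proof (rule Max_eqI)
    show "p \<le> q" if "p \<in> insert 0 {p \<in> V. \<rho> p \<le> \<rho> q}" for p
      using that V01[OF \<open>q \<in> V\<close>] \<rho>_less[of q p] \<open>q \<in> V\<close> by fastforce
  qed (use V(1) that in auto)
  have \<phi>_\<rho>: "\<phi> (\<rho> q) = q" if "q \<in> V" for q
    using \<phi>0_\<rho>[of q] \<phi>0_\<rho>[of "1 - q"] that V01 by (simp add: \<phi>_def \<rho>_refl)
  have \<phi>_mono: "mono \<phi>"
    unfolding \<phi>_def using \<phi>0_mono by (intro monoI divide_right_mono diff_mono add_mono) auto
  have map_\<phi>: "map_entries \<phi> Q \<in> matrices" if Q: "Q \<in> matrices" for Q :: "real ^ 'n::{finite,linorder} ^ 'n::{finite,linorder}"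
    unfolding matrices_iff
  proof (intro allI conjI)
    fix i j
    show "0 \<le> map_entries \<phi> Q $ i $ j"
      using \<phi>0_01[of "Q $ i $ j"] \<phi>0_01[of "1 - Q $ i $ j"] by (simp add: \<phi>_def)
    show "map_entries \<phi> Q $ i $ j + map_entries \<phi> Q $ j $ i = 1"
      unfolding map_entries_nth matrices_entry(3)[OF Q, of i j] \<phi>_def by (simp add: field_simps)
  qed

  have "fair_on (grid m) (\<lambda>Q. f (map_entries \<phi> Q))"
    by (rule fair_on_map_entries[OF f])
      (use map_\<phi> \<phi>_mono in \<open>auto simp: grid_def mono_on_def mono_def\<close>)
  moreover have "map_entries \<phi> (map_entries \<rho> P) = P"
    using \<phi>_\<rho> V(2) by (simp add: vec_eq_iff)
  moreover have "map_entries \<rho> P \<in> doubly_monotonic \<inter> grid m"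
  proof -
    have "map_entries \<rho> P \<in> matrices"
      unfolding matrices_iff using \<rho>_nonneg \<rho>_refl matrices_entry(3)[OF PM]
      by (metis add.commute diff_add_cancel map_entries_nth)
    then show ?thesis
      using P \<rho>_grid \<rho>_mono by (auto simp: doubly_monotonic_def grid_def mono_def antimono_def)
  qed
  ultimately show ?thesis
    by (intro exI[of _ "map_entries \<rho> P"] exI[of _ "\<lambda>Q. f (map_entries \<phi> Q)"]) simp
qed

subsection \<open>Extension from the grid\<close>

text \<open>
  An integer is a fixed point for every \<open>u \<in> {0<..<1}\<close>, and for fixed \<open>y\<close> at most one such \<open>u\<close> makes
  \<open>round_odd u\<close> discontinuous at \<open>y\<close>: averaging over \<open>u\<close> gives a continuous extension from the grid.
\<close>

definition round_odd :: "real \<Rightarrow> real \<Rightarrow> real" where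
  "round_odd u y = sgn y * of_int \<lfloor>\<bar>y\<bar> + u\<rfloor>"

text \<open>For \<open>m > 0\<close> the affine rescaling sends the grid values to the integers from
  \<open>- m\<close> to \<open>m\<close> and reflection about \<open>1 / 2\<close> to a change of
  sign.\<close>

definition round_grid :: "nat \<Rightarrow> real \<Rightarrow> real \<Rightarrow> real" where
  "round_grid m u x = 1 / 2 + round_odd u (2 * real m * (x - 1 / 2)) / (2 * real m)"

lemma round_odd_minus: "round_odd u (- y) = - round_odd u y"
  by (simp add: round_odd_def sgn_minus)

lemma round_odd_nonneg: "0 < u \<Longrightarrow> 0 \<le> y \<Longrightarrow> 0 \<le> round_odd u y"
  by (auto simp: round_odd_def)

lemma round_odd_mono_nonneg:
  assumes "0 < u" "0 \<le> y" "y \<le> z"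
  shows "round_odd u y \<le> round_odd u z"
proof (cases "y = 0")
  case True
  then show ?thesis using round_odd_nonneg[of u z] assms by (simp add: round_odd_def)
next
  case False
  then show ?thesis using assms by (auto simp: round_odd_def intro!: floor_mono)
qed

text \<open>Monotonicity of the floor settles the nonnegative half-line, and oddness transfers it to
  the other half.\<close>

lemma mono_round_odd:
  assumes "0 < u"
  shows "mono (round_odd u)"
proof (rule monoI)
  fix y z :: real assume yz: "y \<le> z"
  consider "0 \<le> y" | "z \<le> 0" | "y \<le> 0" "0 \<le> z" by linarith
  then show "round_odd u y \<le> round_odd u z"
  proof cases
    case 1
    then show ?thesis using round_odd_mono_nonneg assms yz by blast
  next
    case 2
    then have "round_odd u (- z) \<le> round_odd u (- y)"
      using round_odd_mono_nonneg assms yz by auto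
    then show ?thesis by (simp add: round_odd_minus)
  next
    case 3
    then show ?thesis
      using round_odd_nonneg[OF assms, of z] round_odd_nonneg[OF assms, of "- y"]
      by (simp add: round_odd_minus)
  qed
qed

text \<open>\<open>u < 1\<close> prevents the floor from exceeding \<open>m\<close>, so rounding
  does not leave the range of the grid.\<close>

lemma round_odd_bound:
  assumes "0 < u" "u < 1" "\<bar>y\<bar> \<le> real m"
  obtains k :: int where "round_odd u y = of_int k" "\<bar>k\<bar> \<le> int m"
proof
  have "0 \<le> \<lfloor>\<bar>y\<bar> + u\<rfloor>" "\<lfloor>\<bar>y\<bar> + u\<rfloor> \<le> int m" using assms by (auto simp: floor_le_iff)
  then show "\<bar>(if y = 0 then 0 else if 0 < y then 1 else - 1) * \<lfloor>\<bar>y\<bar> + u\<rfloor>\<bar> \<le> int m"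
    by auto
qed (simp add: round_odd_def sgn_if)

lemma round_odd_int: "0 < u \<Longrightarrow> u < 1 \<Longrightarrow> round_odd u (of_int k) = of_int k"
proof -
  assume u: "0 < u" "u < 1"
  have "\<lfloor>\<bar>real_of_int k\<bar> + u\<rfloor> = \<bar>k\<bar>" using u by linarith
  then show ?thesis unfolding round_odd_def by (simp add: sgn_if abs_if)
qed

lemma mono_round_grid: "0 < u \<Longrightarrow> mono (round_grid m u)"
  unfolding round_grid_def
  by (intro monoI add_left_mono divide_right_mono monoD[OF mono_round_odd] mult_left_mono) auto

lemma round_grid_refl: "round_grid m u (1 - x) = 1 - round_grid m u x"
proof -
  have eq: "2 * real m * (1 - x - 1 / 2) = - (2 * real m * (x - 1 / 2))" by (simp add: algebra_simps)
  show ?thesis unfolding round_grid_def eq round_odd_minus by simp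
qed

lemma round_grid_matrix:
  assumes u: "0 < u" "u < 1" and m: "0 < m" and P: "P \<in> matrices"
  shows "map_entries (round_grid m u) P \<in> grid m"
proof -
  have *: "0 \<le> round_grid m u x \<and> round_grid m u x \<in> grid_values m" if x: "0 \<le> x" "x \<le> 1" for x
  proof -
    have "\<bar>x - 1 / 2\<bar> \<le> 1 / 2" using x by linarith
    then have "\<bar>2 * real m * (x - 1 / 2)\<bar> \<le> real m"
      using mult_left_mono[of "\<bar>x - 1 / 2\<bar>" "1 / 2" "2 * real m"] by (simp add: abs_mult)
    then obtain k where k: "round_odd u (2 * real m * (x - 1 / 2)) = of_int k" "\<bar>k\<bar> \<le> int m"
      using round_odd_bound[OF u] by blast
    then have "- real m \<le> real_of_int k" by linarith
    then show ?thesis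
      using k m by (auto simp: round_grid_def grid_values_def field_simps intro!: image_eqI[of _ _ k])
  qed
  have "map_entries (round_grid m u) P \<in> matrices"
    unfolding matrices_iff
  proof (intro allI conjI)
    fix i j
    show "0 \<le> map_entries (round_grid m u) P $ i $ j"
      using * matrices_entry(1,2)[OF P, of i j] by simp
    show "map_entries (round_grid m u) P $ i $ j + map_entries (round_grid m u) P $ j $ i = 1"
      unfolding map_entries_nth matrices_entry(3)[OF P, of i j] round_grid_refl by simp
  qed
  then show ?thesis using * matrices_entry(1,2)[OF P] by (auto simp: grid_def)
qed

text \<open>Ensures that the averaged map agrees with the given one on the grid.\<close>

lemma round_grid_on_grid:
  assumes u: "0 < u" "u < 1" and m: "0 < m" and P: "P \<in> grid m"
  shows "map_entries (round_grid m u) P = P"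
proof -
  have "round_grid m u (P $ i $ j) = P $ i $ j" for i j
  proof -
    obtain k where k: "P $ i $ j = 1 / 2 + of_int k / (2 * real m)"
      using P by (auto simp: grid_def grid_values_def)
    then have "2 * real m * (P $ i $ j - 1 / 2) = of_int k" using m by simp
    then show ?thesis using k round_odd_int[OF u] by (simp add: round_grid_def)
  qed
  then show ?thesis by (simp add: vec_eq_iff)
qed

text \<open>Away from the jumps of the floor, rounding is locally constant.\<close>

lemma eventually_round_grid_eq:
  assumes u: "0 < u" "u < 1" and lim: "(f \<longlongrightarrow> x) F"
    and bad: "\<bar>2 * real m * (x - 1 / 2)\<bar> + u \<notin> \<int>"
  shows "\<forall>\<^sub>F t in F. round_grid m u (f t) = round_grid m u x"
proof -
  define y where "y = 2 * real m * (x - 1 / 2)"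
  have y: "((\<lambda>t. 2 * real m * (f t - 1 / 2)) \<longlongrightarrow> y) F"
    unfolding y_def by (intro tendsto_intros lim)
  then have "((\<lambda>t. \<bar>2 * real m * (f t - 1 / 2)\<bar> + u) \<longlongrightarrow> \<bar>y\<bar> + u) F" by (intro tendsto_intros)
  then have fl: "\<forall>\<^sub>F t in F. \<lfloor>\<bar>2 * real m * (f t - 1 / 2)\<bar> + u\<rfloor> = \<lfloor>\<bar>y\<bar> + u\<rfloor>"
    by (rule eventually_floor_eq) (use bad y_def in simp)
  have "\<forall>\<^sub>F t in F. round_odd u (2 * real m * (f t - 1 / 2)) = round_odd u y"
  proof (cases "y = 0")
    case True
    \<comment> \<open>The sign is not locally constant at 0, but the floor vanishes nearby and with
      it the rounded value.\<close>
    then have "\<lfloor>\<bar>y\<bar> + u\<rfloor> = 0" using u by (simp add: floor_eq_iff)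
    then show ?thesis using fl by (auto simp: round_odd_def elim: eventually_mono)
  next
    case False
    then have "\<forall>\<^sub>F t in F. sgn (2 * real m * (f t - 1 / 2)) = sgn y"
    proof (cases "0 < y")
      case True
      then show ?thesis using order_tendstoD(1)[OF y, of 0] by (auto elim!: eventually_mono)
    next
      case neg: False
      then have "y < 0" using False by simp
      from order_tendstoD(2)[OF y this] show ?thesis
        by eventually_elim (simp only: sgn_neg \<open>y < 0\<close>)
    qed
    then show ?thesis using fl by eventually_elim (simp add: round_odd_def)
  qed
  then show ?thesis by (simp add: round_grid_def y_def)
qed

text \<open>\<open>f P\<close> is the mean of \<open>g\<close> at the rounding of \<open>P\<close>
  with one uniformly random threshold \<open>u\<close> shared by all entries. Each threshold yields
  a fair map, and symmetry, honesty and membership in \<open>prob_vectors\<close> survive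
  averaging.\<close>

lemma fair_value_from_grid:
  fixes g :: "real ^ 'n::finite ^ 'n \<Rightarrow> real ^ 'n"
  assumes g: "fair_on (grid m) g" and m: "0 < m" and fin: "finite (grid m :: (real ^ 'n ^ 'n) set)"
  shows "\<exists>f. continuous_on matrices f \<and> fair_on matrices f \<and> (\<forall>P\<in>grid m. f P = g P)"
proof -
  define M where "M = restrict_space lborel {0<..<1::real}"
  have M: "prob_space M"
    by (rule prob_spaceI) (simp add: M_def emeasure_restrict_space space_restrict_space)
  have spM: "space M = {0<..<1}" by (simp add: M_def space_restrict_space)
  define h where "h P u = g (map_entries (round_grid m u) P)" for P u
  define f where "f P = (\<chi> k. \<integral>u. h P u $ k \<partial>M)" for P
  have fair: "fair_on matrices (\<lambda>P. h P u)" if "u \<in> space M" for u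
    unfolding h_def
    by (rule fair_on_map_entries[OF g]) (use that m round_grid_matrix[of u m] mono_round_grid[of u m]
        in \<open>auto simp: spM mono_on_def mono_def\<close>)
  have meas: "(\<lambda>u. h P u $ k) \<in> borel_measurable M" if P: "P \<in> matrices" for P k
  proof -
    have [measurable]: "(\<lambda>u. round_grid m u x) \<in> borel_measurable M" for x
      unfolding round_grid_def round_odd_def M_def by (intro measurable_restrict_space1) measurable
    have "Measurable.pred M (\<lambda>u. \<forall>i j. round_grid m u (P $ i $ j) = G $ i $ j)" for G
      by measurable
    \<comment> \<open>\<open>g\<close> is not assumed measurable, but only its values on the finite
      grid enter, so \<open>h\<close> is a finite sum of constants on measurable events.\<close>
    then have "(\<lambda>u. \<Sum>G\<in>grid m. if \<forall>i j. round_grid m u (P $ i $ j) = G $ i $ j then g G $ k else 0)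
        \<in> borel_measurable M" (is "?s \<in> _")
      by measurable
    moreover have "?s u = h P u $ k" if "u \<in> space M" for u
    proof -
      define G0 where "G0 = map_entries (round_grid m u) P"
      have "(\<forall>i j. round_grid m u (P $ i $ j) = G $ i $ j) \<longleftrightarrow> G0 = G" for G
        by (auto simp: vec_eq_iff G0_def)
      then have "?s u = (\<Sum>G\<in>grid m. if G0 = G then g G $ k else 0)" by simp
      also have "G0 \<in> grid m"
        unfolding G0_def using that round_grid_matrix[of u m] m P by (auto simp: spM)
      then have "(\<Sum>G\<in>grid m. if G0 = G then g G $ k else 0) = g G0 $ k"
        using fin by simp
      finally show ?thesis by (simp add: h_def G0_def)
    qed
    ultimately show ?thesis by (simp cong: measurable_cong)
  qed
  have h01: "0 \<le> h P u $ k \<and> h P u $ k \<le> 1" if "P \<in> matrices" "u \<in> space M" for P u k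
    using fair_on_prob[OF fair[OF that(2)] that(1)] prob_vectors_le_1[of "h P u" k]
    by (auto simp: prob_vectors_def)
  have int: "integrable M (\<lambda>u. h P u $ k)" if "P \<in> matrices" for P k
    using h01 that by (intro integrable_bounded_prob[OF M meas, where B = 1]) auto
  have "continuous_on matrices f"
    unfolding f_def
  proof (intro continuous_on_vec_lambda continuous_on_integral_bounded[OF M, where B = 1] meas)
    fix P :: "real ^ 'n ^ 'n" and k assume P: "P \<in> matrices"
    \<comment> \<open>Each entry has at most one threshold in the open unit interval at which its
      rounding jumps, so the exceptional set is finite.\<close>
    define bad where "bad = range (\<lambda>(i, j). let y = \<bar>2 * real m * (P $ i $ j - 1 / 2)\<bar> in of_int \<lfloor>y\<rfloor> + 1 - y)"
    have "AE u in lborel. u \<notin> bad"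
      unfolding bad_def by (intro AE_not_in finite_imp_null_set_lborel) auto
    then have "AE u in M. u \<notin> bad"
      unfolding M_def by (subst AE_restrict_space_iff) auto
    moreover have "AE u in M. u \<in> space M" by simp
    ultimately show "AE u in M. continuous (at P within matrices) (\<lambda>Q. h Q u $ k)"
    proof eventually_elim
      case (elim u)
      then have u: "0 < u" "u < 1" by (auto simp: spM)
      have "\<bar>2 * real m * (P $ i $ j - 1 / 2)\<bar> + u \<notin> \<int>" for i j
      proof
        define y where "y = \<bar>2 * real m * (P $ i $ j - 1 / 2)\<bar>"
        assume "\<bar>2 * real m * (P $ i $ j - 1 / 2)\<bar> + u \<in> \<int>"
        then obtain z where z: "y + u = of_int z" by (auto simp: y_def elim: Ints_cases)
        then have "z = \<lfloor>y\<rfloor> + 1" using u by linarith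
        then have "u = of_int \<lfloor>y\<rfloor> + 1 - y" using z by simp
        then have "u \<in> bad" unfolding bad_def y_def by (intro range_eqI[of _ _ "(i, j)"]) (simp add: Let_def)
        then show False using elim by simp
      qed
      then have "\<forall>\<^sub>F Q in at P within matrices. round_grid m u (Q $ i $ j) = round_grid m u (P $ i $ j)" for i j
        by (intro eventually_round_grid_eq u tendsto_vec_nth tendsto_ident_at) auto
      then have "\<forall>\<^sub>F Q in at P within matrices. \<forall>i j. round_grid m u (Q $ i $ j) = round_grid m u (P $ i $ j)"
        by (intro eventually_all_finite)
      then have "\<forall>\<^sub>F Q in at P within matrices. h Q u $ k = h P u $ k"
        by eventually_elim (simp add: h_def map_entries_def)
      then show ?case unfolding continuous_within by (rule tendsto_eventually)
    qed
  qed (use h01 in auto)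
  moreover have "fair_on matrices f"
    unfolding fair_on_def
  proof (intro conjI allI ballI impI)
    fix P :: "real ^ 'n ^ 'n" assume P: "P \<in> matrices"
    have "(\<Sum>k\<in>UNIV. f P $ k) = (\<integral>u. (\<Sum>k\<in>UNIV. h P u $ k) \<partial>M)"
      unfolding f_def using int[OF P] by (simp add: Bochner_Integration.integral_sum)
    also have "\<dots> = (\<integral>u. 1 \<partial>M)"
      using fair_on_prob[OF fair] P by (intro Bochner_Integration.integral_cong) (auto simp: prob_vectors_def)
    finally have "(\<Sum>k\<in>UNIV. f P $ k) = 1" using M by (simp add: prob_space.prob_space)
    then show "f P \<in> prob_vectors"
      using h01 P by (auto simp: f_def prob_vectors_def intro!: Bochner_Integration.integral_nonneg)
  next
    fix P Q :: "real ^ 'n ^ 'n" and \<sigma> i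
    assume "P \<in> matrices" "Q \<in> matrices" "bij \<sigma>" "\<forall>i j. Q $ \<sigma> i $ \<sigma> j = P $ i $ j"
    then show "f P $ i = f Q $ \<sigma> i"
      unfolding f_def using fair_on_symmetric[OF fair]
      by (auto intro!: Bochner_Integration.integral_cong)
  next
    fix i j and P Q :: "real ^ 'n ^ 'n"
    assume *: "i \<noteq> j" "P \<in> matrices" "Q \<in> matrices" "\<forall>k l. {k, l} \<noteq> {i, j} \<longrightarrow> Q $ k $ l = P $ k $ l"
      "P $ i $ j \<le> Q $ i $ j"
    then have "h P u $ i \<le> h Q u $ i" if "u \<in> space M" for u
      using fair_on_honest[OF fair[OF that]] by blast
    then show "f P $ i \<le> f Q $ i"
      unfolding f_def using * int by (auto intro!: integral_mono)
  qed
  moreover have "f P = g P" if P: "P \<in> grid m" for P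
  proof -
    have "(\<integral>u. h P u $ k \<partial>M) = (\<integral>u. g P $ k \<partial>M)" for k
      using round_grid_on_grid[OF _ _ m P] by (intro Bochner_Integration.integral_cong) (auto simp: h_def spM)
    then show ?thesis using M by (simp add: f_def vec_eq_iff prob_space.prob_space)
  qed
  ultimately show ?thesis by blast
qed

subsection \<open>Tournaments that estimate the matrix\<close>

text \<open>
  The score matrix \<open>X\<close> counts at \<open>(i, j)\<close> how often \<open>i\<close> has beaten \<open>j\<close> so far.
\<close>

definition unit_entry :: "'n::finite \<Rightarrow> 'n \<Rightarrow> real ^ 'n ^ 'n" where
  "unit_entry i j = (\<chi> a b. if a = i \<and> b = j then 1 else 0)"

text \<open>The transition operator of one match, acting on functions of the scores.\<close>

definition match_step ::
  "real ^ 'n::finite ^ 'n \<Rightarrow> 'n \<times> 'n \<Rightarrow> (real ^ 'n ^ 'n \<Rightarrow> real) \<Rightarrow> real ^ 'n ^ 'n \<Rightarrow> real" where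
  "match_step P x h X =
     P $ fst x $ snd x * h (X + unit_entry (fst x) (snd x)) +
     P $ snd x $ fst x * h (X + unit_entry (snd x) (fst x))"

text \<open>For \<open>P\<close> in \<open>matrices\<close>, the expectation of \<open>h\<close> at
  the final scores when the listed matches are played from the scores \<open>X\<close>. Written as a
  composition of operators, it reduces reordering matches to commuting operators.\<close>

definition play_all ::
  "real ^ 'n::finite ^ 'n \<Rightarrow> ('n \<times> 'n) list \<Rightarrow> (real ^ 'n ^ 'n \<Rightarrow> real) \<Rightarrow> real ^ 'n ^ 'n \<Rightarrow> real" where
  "play_all P = foldr (match_step P)"

lemma play_all_Nil [simp]: "play_all P [] h X = h X"
  by (simp add: play_all_def)

lemma play_all_Cons:
  "play_all P (x # xs) h X =
     P $ fst x $ snd x * play_all P xs h (X + unit_entry (fst x) (snd x)) +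
     P $ snd x $ fst x * play_all P xs h (X + unit_entry (snd x) (fst x))"
  by (simp add: play_all_def match_step_def)

primrec schedule ::
  "(real ^ 'n::finite ^ 'n \<Rightarrow> 'n tournament) \<Rightarrow> ('n \<times> 'n) list \<Rightarrow> real ^ 'n ^ 'n \<Rightarrow> 'n tournament" where
  "schedule F [] X = F X"
| "schedule F (x # xs) X =
     Play (fst x) (snd x)
       (schedule F xs (X + unit_entry (fst x) (snd x)))
       (schedule F xs (X + unit_entry (snd x) (fst x)))"

lemma unit_entry_nth: "unit_entry i j $ a $ b = (if a = i \<and> b = j then 1 else 0)"
  by (simp add: unit_entry_def)

lemma win_prob_schedule:
  "win_prob (schedule F xs X) P k = play_all P xs (\<lambda>X. win_prob (F X) P k) X"
  by (induction xs arbitrary: X) (simp_all add: play_all_Cons)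

lemma play_all_mono:
  assumes "P \<in> matrices" "\<And>Y. h Y \<le> h' Y"
  shows "play_all P xs h X \<le> play_all P xs h' X"
proof (induction xs arbitrary: X)
  case (Cons x xs)
  then show ?case
    using matrices_entry(1)[OF assms(1)] by (auto simp: play_all_Cons intro!: add_mono mult_left_mono)
qed (use assms in auto)

text \<open>The two weights of a match add up to 1, so constants are preserved, as for an
  expectation.\<close>

lemma play_all_affine:
  assumes P: "P \<in> matrices"
  shows "play_all P xs (\<lambda>Y. c + d * h Y) X = c + d * play_all P xs h X"
proof (induction xs arbitrary: X)
  case (Cons x xs)
  show ?case
    unfolding play_all_Cons Cons matrices_entry(3)[OF P, of "fst x" "snd x"]
    by (simp add: algebra_simps)
qed auto

lemma play_all_sum:
  assumes P: "P \<in> matrices"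
  shows "play_all P xs (\<lambda>Y. \<Sum>a\<in>A. h a Y) X = (\<Sum>a\<in>A. play_all P xs (h a) X)"
  by (induction xs arbitrary: X) (simp_all add: play_all_Cons sum.distrib sum_distrib_left)

text \<open>Each of the \<open>N\<close> matches between \<open>a\<close> and \<open>b\<close>
  changes the score difference by an independent step \<open>1\<close> or \<open>- 1\<close> with
  mean \<open>d\<close> and variance \<open>1 - d\<^sup>2\<close>; the result is squared bias plus
  variance. The arbitrary start \<open>X\<close> carries the induction.\<close>

lemma play_all_second_moment:
  assumes P: "P \<in> matrices" and ab: "a \<noteq> b" and xs: "\<forall>x\<in>set xs. fst x \<noteq> snd x"
    and d: "d = P $ a $ b - P $ b $ a"
    and N: "N = real (length (filter (\<lambda>x. {fst x, snd x} = {a, b}) xs))"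
  shows "play_all P xs (\<lambda>Y. (Y $ a $ b - Y $ b $ a - s)\<^sup>2) X =
    (X $ a $ b - X $ b $ a + N * d - s)\<^sup>2 + N * (1 - d\<^sup>2)"
  using xs N
proof (induction xs arbitrary: X N)
  case Nil
  then show ?case by simp
next
  case (Cons x xs)
  define N' where "N' = real (length (filter (\<lambda>x. {fst x, snd x} = {a, b}) xs))"
  note IH = Cons.IH[OF _ N'_def]
  have xs': "\<forall>x\<in>set xs. fst x \<noteq> snd x" using Cons.prems(1) by simp
  have p: "P $ a $ b = (1 + d) / 2" "P $ b $ a = (1 - d) / 2"
    using matrices_entry(3)[OF P, of a b] d by (simp_all add: field_simps)
  consider "x = (a, b)" | "x = (b, a)" | "{fst x, snd x} \<noteq> {a, b}"
    by (cases x) (auto simp: doubleton_eq_iff)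
  then show ?case
  proof cases
    case 1
    then have "N = N' + 1" using Cons.prems N'_def by simp
    then show ?thesis
      unfolding 1 play_all_Cons fst_conv snd_conv IH[OF xs'] p using ab
      by (simp add: unit_entry_nth power2_eq_square field_simps)
  next
    case 2
    then have "N = N' + 1" using Cons.prems N'_def by (simp add: insert_commute)
    then show ?thesis
      unfolding 2 play_all_Cons fst_conv snd_conv IH[OF xs'] p using ab
      by (simp add: unit_entry_nth power2_eq_square field_simps)
  next
    case 3
    then have "unit_entry (fst x) (snd x) $ a $ b = 0" "unit_entry (fst x) (snd x) $ b $ a = 0"
      "unit_entry (snd x) (fst x) $ a $ b = 0" "unit_entry (snd x) (fst x) $ b $ a = 0"
      by (auto simp: unit_entry_def)
    moreover have "N = N'" using 3 Cons.prems N'_def by simp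
    ultimately show ?thesis
      using Cons.prems(1)
      by (simp add: play_all_Cons IH matrices_entry(3)[OF P, of "fst x" "snd x"]) (simp add: algebra_simps)
  qed
qed

text \<open>Score increments commute, hence so do the operators of any two matches.\<close>

lemma play_all_mset:
  assumes "mset xs = mset ys"
  shows "play_all P xs = play_all P ys"
proof -
  have "match_step P x \<circ> match_step P y = match_step P y \<circ> match_step P x" for x y
    by (simp add: fun_eq_iff match_step_def algebra_simps)
  then show ?thesis
    unfolding play_all_def foldr_conv_fold using assms by (intro fold_multiset_equiv) auto
qed

text \<open>\<open>Q\<close>, \<open>Z\<close> and \<open>h'\<close> are \<open>P\<close>,
  \<open>X\<close> and \<open>h\<close> transported along \<open>\<sigma>\<close>; each relabelled
  match has the same probabilities and leads to transported scores.\<close>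

lemma play_all_relabel:
  assumes \<sigma>: "bij \<sigma>" and PQ: "\<And>i j. Q $ \<sigma> i $ \<sigma> j = P $ i $ j"
    and h: "\<And>Y Z. (\<And>i j. Z $ \<sigma> i $ \<sigma> j = Y $ i $ j) \<Longrightarrow> h' Z = h Y"
  shows "(\<And>i j. Z $ \<sigma> i $ \<sigma> j = X $ i $ j) \<Longrightarrow>
    play_all Q (map (map_prod \<sigma> \<sigma>) xs) h' Z = play_all P xs h X"
proof (induction xs arbitrary: X Z)
  case Nil
  then show ?case using h by simp
next
  case (Cons x xs)
  have \<sigma>_eq: "\<sigma> i = \<sigma> j \<longleftrightarrow> i = j" for i j using \<sigma> by (simp add: bij_def inj_eq)
  have "play_all Q (map (map_prod \<sigma> \<sigma>) xs) h' (Z + unit_entry (\<sigma> i) (\<sigma> j)) = play_all P xs h (X + unit_entry i j)" for i j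
    by (rule Cons.IH) (simp add: Cons.prems unit_entry_def \<sigma>_eq)
  then show ?case by (simp add: play_all_Cons PQ)
qed

text \<open>Couples two runs with the same future results: the increments \<open>E\<close> and
  \<open>E'\<close> persist unchanged to the end. Applied to the two outcomes of an announced match,
  this gives honesty.\<close>

lemma play_all_step_mono:
  assumes P: "P \<in> matrices" and h: "\<And>Y. h (Y + E) \<le> h (Y + E')"
  shows "play_all P xs h (X + E) \<le> play_all P xs h (X + E')"
proof (induction xs arbitrary: X)
  case (Cons x xs)
  have "play_all P xs h (X + E + U) \<le> play_all P xs h (X + E' + U)" for U
    using Cons[of "X + U"] by (simp add: ac_simps)
  then show ?case
    using matrices_entry(1)[OF P] by (auto simp: play_all_Cons intro!: add_mono mult_left_mono)
qed (use h in auto)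

text \<open>
  \<open>N\<close> is the number of matches of each pair. The estimate is written in terms of the difference of
  the two scores and truncated, so that it lies in \<^const>\<open>matrices\<close> for every score matrix.
\<close>

definition estimate :: "real \<Rightarrow> real ^ 'n::finite ^ 'n \<Rightarrow> real ^ 'n ^ 'n" where
  "estimate N X = (\<chi> a b. max 0 (min 1 (1 / 2 + (X $ a $ b - X $ b $ a) / (2 * N))))"

text \<open>Truncation to the unit interval commutes with reflection about
  \<open>1 / 2\<close>.\<close>

lemma estimate_matrix: "estimate N X \<in> matrices"
  unfolding matrices_iff
proof (intro allI conjI)
  fix a b
  have clamp: "max 0 (min 1 (1 / 2 + z)) + max 0 (min 1 (1 / 2 + - z)) = 1" for z :: real
    by (auto simp: max_def min_def)
  have "(X $ b $ a - X $ a $ b) / (2 * N) = - ((X $ a $ b - X $ b $ a) / (2 * N))"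
    by (simp add: minus_divide_left)
  then show "estimate N X $ a $ b + estimate N X $ b $ a = 1"
    by (simp only: estimate_def vec_lambda_beta clamp)
qed (simp add: estimate_def)

text \<open>
  Random choices are real numbers, so the players are encoded by \<^const>\<open>to_nat\<close>.
\<close>

definition lottery :: "real ^ 'n::finite \<Rightarrow> 'n tournament" where
  "lottery v = Chance (measure_pmf (map_pmf (real \<circ> to_nat) (embed_pmf (($) v))))
     (\<lambda>u. Winner (inv (real \<circ> to_nat) u))"

lemma win_prob_lottery:
  assumes "v \<in> prob_vectors"
  shows "win_prob (lottery v) P k = v $ k"
proof -
  have inj: "inj (real \<circ> (to_nat :: 'a \<Rightarrow> nat))"
    by (intro inj_compose inj_of_nat) simp
  have v: "0 \<le> v $ i" "(\<Sum>i\<in>UNIV. v $ i) = 1" for i using assms by (auto simp: prob_vectors_def)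
  have "(\<integral>\<^sup>+ i. ennreal (v $ i) \<partial>count_space UNIV) = 1"
    using v by (simp add: nn_integral_count_space_finite sum_ennreal)
  then have "pmf (embed_pmf (($) v)) i = v $ i" for i
    using v by (intro pmf_embed_pmf) auto
  then have "(\<integral>w. (if k = w then 1 else 0) \<partial>measure_pmf (embed_pmf (($) v))) = v $ k"
    by (subst integral_measure_pmf_real[where A = UNIV]) (auto simp: mult_if_delta)
  then show ?thesis using inv_f_f[OF inj] by (simp add: lottery_def)
qed

text \<open>Reduces conditions on all states to two kinds: the states of the final stage
  \<open>F\<close>, and those in which a listed match is about to be played.\<close>

lemma states_schedule:
  assumes "U \<in> states (schedule F xs X)"
  shows "(\<exists>Y. U \<in> states (F Y)) \<or>
    (\<exists>x\<in>set xs. \<exists>ys Y. U = schedule F (x # ys) Y)"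
  using assms
proof (induction xs arbitrary: X)
  case (Cons x xs)
  then consider "U = schedule F (x # xs) X"
    | "U \<in> states (schedule F xs (X + unit_entry (fst x) (snd x)))"
    | "U \<in> states (schedule F xs (X + unit_entry (snd x) (fst x)))"
    by auto
  then show ?case
  proof cases
    case 1
    then show ?thesis by (metis list.set_intros(1))
  qed (use Cons.IH in \<open>(meson list.set_intros(2))+\<close>)
qed auto

lemma states_lottery:
  "U \<in> states (lottery v) \<Longrightarrow> U = lottery v \<or> (\<exists>w. U = Winner w)"
  by (auto simp: lottery_def)

lemma Play_notin_states_lottery: "Play i j A B \<notin> states (lottery v)"
  by (auto simp: lottery_def)

lemma at_most_matches_schedule:
  "(\<And>X. at_most_matches (F X) 0) \<Longrightarrow> at_most_matches (schedule F xs X) (length xs)"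
  by (induction xs arbitrary: X) auto

section \<open>The estimating tournament: honesty, symmetry and accuracy\<close>

definition estimating_tournament ::
  "(real ^ 'n::finite ^ 'n \<Rightarrow> real ^ 'n) \<Rightarrow> real \<Rightarrow> ('n \<times> 'n) list \<Rightarrow> 'n tournament" where
  "estimating_tournament f N xs = schedule (\<lambda>X. lottery (f (estimate N X))) xs 0"

context
  fixes f :: "real ^ 'n::finite ^ 'n \<Rightarrow> real ^ 'n" and N :: real and xs :: "('n \<times> 'n) list"
  assumes f: "fair_on matrices f" and N: "0 < N" and xs: "\<forall>x\<in>set xs. fst x \<noteq> snd x"
begin

lemma win_prob_lottery_estimate:
  "win_prob (lottery (f (estimate N X))) P k = f (estimate N X) $ k"
  using fair_on_prob[OF f estimate_matrix] by (rule win_prob_lottery)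

lemma win_prob_estimating:
  "win_prob (schedule (\<lambda>X. lottery (f (estimate N X))) ys X) P k =
     play_all P ys (\<lambda>X. f (estimate N X) $ k) X"
  by (simp add: win_prob_schedule win_prob_lottery_estimate)

lemma is_tournament_estimating: "is_tournament (estimating_tournament f N xs)"
  unfolding is_tournament_def
proof (intro conjI allI impI)
  fix i j A B
  assume "Play i j A B \<in> states (estimating_tournament f N xs)"
  then show "i \<noteq> j"
    unfolding estimating_tournament_def
    using states_schedule states_lottery xs by (fastforce simp: lottery_def)
next
  fix M F assume "Chance M F \<in> states (estimating_tournament f N xs)"
  then obtain v where MF: "Chance M F = lottery v"
    unfolding estimating_tournament_def using states_schedule states_lottery by fastforce
  then show "prob_space M" by (auto simp: lottery_def prob_space_measure_pmf)
  have "M = measure_pmf (map_pmf (real \<circ> to_nat) (embed_pmf (($) v)))"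
    using MF by (simp add: lottery_def)
  then show "\<forall>P\<in>matrices. \<forall>k. (\<lambda>u. win_prob (F u) P k) \<in> borel_measurable M" by simp
next
  show "\<exists>r. at_most_matches (estimating_tournament f N xs) r"
    unfolding estimating_tournament_def
    by (intro exI[of _ "length xs"] at_most_matches_schedule) (simp add: lottery_def)
qed

text \<open>Winning instead of losing against \<open>j\<close> changes only the estimates for this
  pair, in favour of \<open>i\<close>, so honesty of \<open>f\<close> applies.\<close>

lemma estimate_honest:
  assumes "i \<noteq> j"
  shows "f (estimate N (Y + unit_entry j i)) $ i \<le> f (estimate N (Y + unit_entry i j)) $ i"
proof (rule fair_on_honest[OF f \<open>i \<noteq> j\<close> estimate_matrix estimate_matrix])
  show "estimate N (Y + unit_entry i j) $ k $ l = estimate N (Y + unit_entry j i) $ k $ l"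
    if "{k, l} \<noteq> {i, j}" for k l
  proof -
    have "unit_entry i j $ k $ l = 0" "unit_entry i j $ l $ k = 0"
      "unit_entry j i $ k $ l = 0" "unit_entry j i $ l $ k = 0"
      using that by (auto simp: unit_entry_nth insert_commute)
    then show ?thesis by (simp add: estimate_def)
  qed
  show "estimate N (Y + unit_entry j i) $ i $ j \<le> estimate N (Y + unit_entry i j) $ i $ j"
    unfolding estimate_def vec_lambda_beta
    by (intro max.mono min.mono add_mono order_refl divide_right_mono) (use assms N in \<open>auto simp: unit_entry_nth\<close>)
qed

text \<open>The remaining matches are the same for both outcomes, so
  \<open>play_all_step_mono\<close> carries \<open>estimate_honest\<close> from the end back to the
  announced match.\<close>

lemma honest_estimating: "honest_tournament (estimating_tournament f N xs)"
  unfolding honest_tournament_def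
proof (intro allI impI ballI)
  fix i j A B and P :: "real ^ 'n ^ 'n"
  assume "Play i j A B \<in> states (estimating_tournament f N xs)" and P: "P \<in> matrices"
  then obtain x ys Y where "x \<in> set xs"
    "Play i j A B = schedule (\<lambda>X. lottery (f (estimate N X))) (x # ys) Y"
    unfolding estimating_tournament_def
    using states_schedule Play_notin_states_lottery by blast
  then have "i \<noteq> j" "A = schedule (\<lambda>X. lottery (f (estimate N X))) ys (Y + unit_entry i j)"
    "B = schedule (\<lambda>X. lottery (f (estimate N X))) ys (Y + unit_entry j i)"
    using xs by auto
  then show "win_prob B P i \<le> win_prob A P i \<and> win_prob A P j \<le> win_prob B P j"
    by (auto simp: win_prob_estimating intro!: play_all_step_mono P estimate_honest)
qed

text \<open>Relabelling the players only permutes the list of matches, which leaves expectations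
  unchanged by \<open>play_all_mset\<close>.\<close>

lemma symmetric_estimating:
  assumes inv: "\<And>\<sigma>. bij \<sigma> \<Longrightarrow> mset (map (map_prod \<sigma> \<sigma>) xs) = mset xs"
  shows "symmetric_tournament (estimating_tournament f N xs)"
  unfolding symmetric_tournament_def symmetric_map_def
proof (intro ballI allI impI)
  fix P Q :: "real ^ 'n ^ 'n" and \<sigma> :: "'n \<Rightarrow> 'n" and i
  assume *: "bij \<sigma>" "\<forall>i j. Q $ \<sigma> i $ \<sigma> j = P $ i $ j"
  have "play_all Q xs (\<lambda>X. f (estimate N X) $ \<sigma> i) 0 =
      play_all Q (map (map_prod \<sigma> \<sigma>) xs) (\<lambda>X. f (estimate N X) $ \<sigma> i) 0"
    using play_all_mset[OF inv[OF *(1)]] by simp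
  also have "\<dots> = play_all P xs (\<lambda>X. f (estimate N X) $ i) 0"
  proof (rule play_all_relabel[OF *(1)])
    fix Y Z :: "real ^ 'n ^ 'n"
    assume "\<And>i j. Z $ \<sigma> i $ \<sigma> j = Y $ i $ j"
    then show "f (estimate N Z) $ \<sigma> i = f (estimate N Y) $ i"
      by (intro fair_on_symmetric[OF f estimate_matrix estimate_matrix *(1), symmetric]) (simp add: estimate_def)
  qed (use * in auto)
  finally show "win_vector (estimating_tournament f N xs) P $ i =
      win_vector (estimating_tournament f N xs) Q $ \<sigma> i"
    by (simp add: win_vector_def estimating_tournament_def win_prob_estimating)
qed

text \<open>For \<open>a \<noteq> b\<close> the score difference has mean \<open>N * d\<close> and
  variance at most \<open>N\<close>, and the estimate rescales it by \<open>1 / (2 * N)\<close>.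
  Truncation does not increase the distance to an entry in the unit interval.\<close>

lemma estimate_error:
  assumes P: "P \<in> matrices"
    and len: "\<And>a b. a \<noteq> b \<Longrightarrow> real (length (filter (\<lambda>x. {fst x, snd x} = {a, b}) xs)) = N"
  shows "play_all P xs (\<lambda>Y. (estimate N Y $ a $ b - P $ a $ b)\<^sup>2) 0 \<le> 1 / (4 * N)"
proof (cases "a = b")
  case True
  \<comment> \<open>On the diagonal both sides are \<open>1 / 2\<close>.\<close>
  have "estimate N Y $ a $ b = P $ a $ b" for Y
    using True matrices_entry(3)[OF P, of a a] by (simp add: estimate_def)
  then show ?thesis
    using play_all_affine[OF P, of xs 0 0] N by (simp add: zero_power2)
next
  case False
  define d where "d = P $ a $ b - P $ b $ a"
  define h where "h Y = (Y $ a $ b - Y $ b $ a - N * d)\<^sup>2" for Y :: "real ^ 'n ^ 'n"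
  have p: "P $ a $ b = 1 / 2 + d / 2" using matrices_entry(3)[OF P, of a b] d_def by (simp add: field_simps)
  \<comment> \<open>The summand 0 gives the bound the shape required by
    \<open>play_all_affine\<close>.\<close>
  have "(estimate N Y $ a $ b - P $ a $ b)\<^sup>2 \<le> 0 + 1 / (4 * N\<^sup>2) * h Y" for Y
  proof -
    have "\<bar>max 0 (min 1 z) - P $ a $ b\<bar> \<le> \<bar>z - P $ a $ b\<bar>" for z
      using matrices_entry(1,2)[OF P, of a b] by (auto simp: max_def min_def)
    then have "\<bar>estimate N Y $ a $ b - P $ a $ b\<bar>
        \<le> \<bar>1 / 2 + (Y $ a $ b - Y $ b $ a) / (2 * N) - P $ a $ b\<bar>"
      by (simp add: estimate_def)
    also have "1 / 2 + (Y $ a $ b - Y $ b $ a) / (2 * N) - P $ a $ b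
        = (Y $ a $ b - Y $ b $ a - N * d) / (2 * N)"
      using N by (simp add: p field_simps)
    finally have "(estimate N Y $ a $ b - P $ a $ b)\<^sup>2 \<le> ((Y $ a $ b - Y $ b $ a - N * d) / (2 * N))\<^sup>2"
      by (simp only: abs_le_square_iff)
    then show ?thesis by (simp add: h_def power_divide power_mult_distrib)
  qed
  then have "play_all P xs (\<lambda>Y. (estimate N Y $ a $ b - P $ a $ b)\<^sup>2) 0
      \<le> play_all P xs (\<lambda>Y. 0 + 1 / (4 * N\<^sup>2) * h Y) 0"
    by (rule play_all_mono[OF P])
  also have "\<dots> = 1 / (4 * N\<^sup>2) * play_all P xs h 0"
    unfolding play_all_affine[OF P] by simp
  also have "play_all P xs h 0 = N * (1 - d\<^sup>2)"
    unfolding h_def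
    by (subst play_all_second_moment[OF P False xs d_def len[OF False, symmetric]]) simp
  also have "1 / (4 * N\<^sup>2) * (N * (1 - d\<^sup>2)) \<le> 1 / (4 * N\<^sup>2) * (N * 1)"
    using N by (intro mult_left_mono) auto
  also have "\<dots> = 1 / (4 * N)" using N by (simp add: power2_eq_square)
  finally show ?thesis .
qed

text \<open>Chebyshev's inequality in expectation form: the squared distance of the estimate from
  \<open>P\<close>, divided by \<open>\<delta>\<^sup>2\<close>, dominates the indicator of a bad
  estimate.\<close>

lemma win_vector_estimating_close:
  assumes P: "P \<in> matrices"
    and len: "\<And>a b. a \<noteq> b \<Longrightarrow> real (length (filter (\<lambda>x. {fst x, snd x} = {a, b}) xs)) = N"
    and \<delta>: "0 < \<delta>" "\<And>Q. Q \<in> matrices \<Longrightarrow> dist Q P < \<delta> \<Longrightarrow> dist (f Q) (f P) < \<epsilon>" and \<epsilon>: "0 < \<epsilon>"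
  shows "\<bar>win_vector (estimating_tournament f N xs) P $ k - f P $ k\<bar>
    \<le> \<epsilon> + (real CARD('n))\<^sup>2 / (4 * N * \<delta>\<^sup>2)"
proof -
  define D where "D Y = (\<Sum>a\<in>UNIV. \<Sum>b\<in>UNIV. (estimate N Y $ a $ b - P $ a $ b)\<^sup>2)" for Y
  define E where "E = play_all P xs D 0"
  have D_dist: "D Y = (dist (estimate N Y) P)\<^sup>2" for Y
    unfolding D_def dist_norm power2_norm_eq_inner by (simp add: inner_vec_def power2_eq_square)
  \<comment> \<open>Within distance \<open>\<delta>\<close> the choice of \<open>\<delta>\<close>
    gives \<open>\<epsilon>\<close>; beyond it the second term is at least 1, which bounds any
    difference of two probabilities.\<close>
  have bound: "\<bar>f (estimate N Y) $ k - f P $ k\<bar> \<le> \<epsilon> + 1 / \<delta>\<^sup>2 * D Y" for Y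
  proof (cases "dist (estimate N Y) P < \<delta>")
    case True
    then have "\<bar>f (estimate N Y) $ k - f P $ k\<bar> \<le> \<epsilon>"
      using \<delta>(2)[OF estimate_matrix True] component_le_norm_cart[of "f (estimate N Y) - f P" k]
      by (simp add: dist_norm)
    then show ?thesis by (simp add: D_dist add_increasing2)
  next
    case False
    have "\<bar>f (estimate N Y) $ k - f P $ k\<bar> \<le> 1"
      using fair_on_prob[OF f estimate_matrix, of N Y] fair_on_prob[OF f P]
        prob_vectors_le_1[of "f (estimate N Y)" k] prob_vectors_le_1[of "f P" k]
      by (auto simp: prob_vectors_def abs_le_iff) (smt (verit))+
    also have "1 \<le> 1 / \<delta>\<^sup>2 * D Y"
      using False \<delta>(1) power_mono[of \<delta> "dist (estimate N Y) P" 2] by (simp add: D_dist field_simps)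
    finally show ?thesis using \<epsilon> by simp
  qed
  have "E \<le> (\<Sum>a\<in>(UNIV :: 'n set). \<Sum>b\<in>(UNIV :: 'n set). 1 / (4 * N))"
    unfolding E_def D_def play_all_sum[OF P] by (intro sum_mono estimate_error[OF P]; rule len)
  then have "E \<le> (real CARD('n))\<^sup>2 / (4 * N)" by (simp add: power2_eq_square)
  then have "1 / \<delta>\<^sup>2 * E \<le> 1 / \<delta>\<^sup>2 * ((real CARD('n))\<^sup>2 / (4 * N))" by (intro mult_left_mono) auto
  then have E: "1 / \<delta>\<^sup>2 * E \<le> (real CARD('n))\<^sup>2 / (4 * N * \<delta>\<^sup>2)" by (simp add: mult.commute)
  have w: "win_vector (estimating_tournament f N xs) P $ k = play_all P xs (\<lambda>X. f (estimate N X) $ k) 0"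
    by (simp add: win_vector_def estimating_tournament_def win_prob_estimating)
  have "play_all P xs (\<lambda>X. f (estimate N X) $ k) 0 \<le> play_all P xs (\<lambda>X. (f P $ k + \<epsilon>) + 1 / \<delta>\<^sup>2 * D X) 0"
    by (rule play_all_mono[OF P]) (use bound in \<open>simp add: abs_le_iff algebra_simps\<close>)
  also have "\<dots> = f P $ k + \<epsilon> + 1 / \<delta>\<^sup>2 * E" unfolding play_all_affine[OF P] E_def ..
  finally have upper: "win_vector (estimating_tournament f N xs) P $ k \<le> f P $ k + \<epsilon> + 1 / \<delta>\<^sup>2 * E"
    by (simp add: w)
  \<comment> \<open>\<open>play_all_mono\<close> compares one-sided bounds, so the lower estimate is
    integrated separately, with a negative coefficient.\<close>
  have "f P $ k - \<epsilon> - 1 / \<delta>\<^sup>2 * D Y \<le> f (estimate N Y) $ k" for Y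
    using bound[of Y] by linarith
  then have "play_all P xs (\<lambda>X. (f P $ k - \<epsilon>) + (- 1 / \<delta>\<^sup>2) * D X) 0 \<le> play_all P xs (\<lambda>X. f (estimate N X) $ k) 0"
    by (intro play_all_mono[OF P]) simp
  also have "play_all P xs (\<lambda>X. (f P $ k - \<epsilon>) + (- 1 / \<delta>\<^sup>2) * D X) 0 = f P $ k - \<epsilon> + (- 1 / \<delta>\<^sup>2) * E"
    unfolding play_all_affine[OF P] E_def ..
  finally have "f P $ k - \<epsilon> - 1 / \<delta>\<^sup>2 * E \<le> win_vector (estimating_tournament f N xs) P $ k"
    by (simp add: w)
  with upper E show ?thesis by linarith
qed

end

section \<open>Balanced schedules and approximation of fair maps\<close>

lemma ex_balanced_schedule:
  fixes K :: nat
  shows "\<exists>xs :: ('n::finite \<times> 'n) list. (\<forall>x\<in>set xs. fst x \<noteq> snd x) \<and>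
    (\<forall>\<sigma>. bij \<sigma> \<longrightarrow> mset (map (map_prod \<sigma> \<sigma>) xs) = mset xs) \<and>
    (\<forall>a b. a \<noteq> b \<longrightarrow> length (filter (\<lambda>x. {fst x, snd x} = {a, b}) xs) = 2 * K)"
proof -
  \<comment> \<open>Listing the ordered pairs makes the schedule invariant under relabelling; each match then occurs twice.\<close>
  define A where "A = {x :: 'n \<times> 'n. fst x \<noteq> snd x}"
  obtain ps where ps: "set ps = A" "distinct ps" using finite_distinct_list[of A] by auto
  define xs where "xs = concat (replicate K ps)"
  have "mset (map (map_prod \<sigma> \<sigma>) xs) = mset xs" if \<sigma>: "bij \<sigma>" for \<sigma>
  proof -
    have inj: "inj (map_prod \<sigma> \<sigma>)" using \<sigma> by (intro prod.inj_map) (auto simp: bij_def)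
    have "map_prod \<sigma> \<sigma> ` A \<subseteq> A" using \<sigma> by (auto simp: A_def bij_def inj_eq)
    then have "map_prod \<sigma> \<sigma> ` A = A"
      using inj by (intro endo_inj_surj) (auto intro: inj_on_subset)
    then have "mset (map (map_prod \<sigma> \<sigma>) ps) = mset ps"
      using ps inj by (intro set_eq_iff_mset_eq_distinct[THEN iffD1]) (auto simp: distinct_map intro: inj_on_subset)
    then show ?thesis unfolding xs_def by (induction K) auto
  qed
  moreover have "length (filter (\<lambda>x. {fst x, snd x} = {a, b}) xs) = 2 * K" if "a \<noteq> b" for a b
  proof -
    have "set (filter (\<lambda>x. {fst x, snd x} = {a, b}) ps) = {x \<in> A. {fst x, snd x} = {a, b}}"
      using ps(1) by simp
    also have "\<dots> = {(a, b), (b, a)}"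
      unfolding A_def doubleton_eq_iff using that by fastforce
    finally have "card (set (filter (\<lambda>x. {fst x, snd x} = {a, b}) ps)) = 2"
      using that by (simp only:) simp
    then have "length (filter (\<lambda>x. {fst x, snd x} = {a, b}) ps) = 2"
      by (simp only: distinct_card[OF distinct_filter[OF ps(2)]])
    then show ?thesis unfolding xs_def by (induction K) auto
  qed
  moreover have "\<forall>x\<in>set xs. fst x \<noteq> snd x" using ps by (auto simp: xs_def A_def)
  ultimately show ?thesis by blast
qed

lemma fair_map_approximable:
  fixes f :: "real ^ 'n::finite ^ 'n \<Rightarrow> real ^ 'n"
  assumes f: "fair_on matrices f" and cont: "continuous_on matrices f" and P: "P \<in> matrices" and e: "0 < e"
  shows "\<exists>T. is_tournament T \<and> symmetric_tournament T \<and> honest_tournament T \<and> dist (win_vector T P) (f P) < e"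
proof -
  define n where "n = real CARD('n)"
  have n: "0 < n" by (simp add: n_def)
  \<comment> \<open>Each of the \<open>n\<close> coordinates will be off by at most
    \<open>2 * \<epsilon>\<close>, which gives an error of at most \<open>e / 2\<close> in the sum
    norm.\<close>
  define \<epsilon> where "\<epsilon> = e / (4 * n)"
  have \<epsilon>: "0 < \<epsilon>" using e n by (simp add: \<epsilon>_def)
  obtain \<delta> where \<delta>: "0 < \<delta>" "\<And>Q. Q \<in> matrices \<Longrightarrow> dist Q P < \<delta> \<Longrightarrow> dist (f Q) (f P) < \<epsilon>"
    using cont P \<epsilon> unfolding continuous_on_iff by metis
  \<comment> \<open>With \<open>N = 2 * K\<close> this bound on \<open>K\<close> says exactly that
    \<open>n\<^sup>2 / (4 * N * \<delta>\<^sup>2)\<close> is below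
    \<open>\<epsilon>\<close>.\<close>
  obtain K0 :: nat where K0: "n\<^sup>2 / (8 * \<delta>\<^sup>2 * \<epsilon>) < real K0" using reals_Archimedean2 by blast
  define K where "K = Suc K0"
  have K: "n\<^sup>2 / (8 * \<delta>\<^sup>2 * \<epsilon>) < real K" "0 < real K" using K0 by (auto simp: K_def)
  define N where "N = real (2 * K)"
  have N: "0 < N" using K by (simp add: N_def)
  obtain xs :: "('n \<times> 'n) list" where xs: "\<forall>x\<in>set xs. fst x \<noteq> snd x"
    "\<And>\<sigma>. bij \<sigma> \<Longrightarrow> mset (map (map_prod \<sigma> \<sigma>) xs) = mset xs"
    and count: "\<And>a b. a \<noteq> b \<Longrightarrow> length (filter (\<lambda>x. {fst x, snd x} = {a, b}) xs) = 2 * K"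
    using ex_balanced_schedule[where K = K and 'n = 'n] by blast
  define T where "T = estimating_tournament f N xs"
  have small: "n\<^sup>2 / (4 * N * \<delta>\<^sup>2) < \<epsilon>"
    using K \<delta>(1) \<epsilon> by (simp add: N_def field_simps)
  have close: "\<bar>win_vector T P $ k - f P $ k\<bar> \<le> \<epsilon> + n\<^sup>2 / (4 * N * \<delta>\<^sup>2)" for k
    unfolding T_def n_def
    by (rule win_vector_estimating_close[OF f N xs(1) P _ \<delta>(1) _ \<epsilon>]) (use count \<delta>(2) in \<open>auto simp: N_def\<close>)
  have "\<bar>win_vector T P $ k - f P $ k\<bar> \<le> 2 * \<epsilon>" for k
    using small close[of k] by linarith
  then have "(\<Sum>k\<in>UNIV. \<bar>(win_vector T P - f P) $ k\<bar>) \<le> (\<Sum>k\<in>(UNIV :: 'n set). 2 * \<epsilon>)"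
    by (intro sum_mono) simp
  also have "\<dots> = e / 2" using n by (simp add: \<epsilon>_def n_def)
  finally have "dist (win_vector T P) (f P) < e"
    using norm_le_l1_cart[of "win_vector T P - f P"] e by (simp add: dist_norm)
  moreover have "symmetric_tournament T"
    unfolding T_def by (rule symmetric_estimating[OF f N xs(1)]) (rule xs(2))
  ultimately show ?thesis
    using is_tournament_estimating[OF f N xs(1)] honest_estimating[OF f N xs(1)] unfolding T_def by blast
qed

section \<open>Comparison of the two sets of win vectors\<close>

theorem mainTheorem8:
  shows "(map_win_vectors :: (real ^ 'n::{finite,linorder}) set) = tournament_win_vectors \<and>
    (\<exists>F. finite F \<and> (\<forall>K\<in>F. polytope K) \<and>
       (map_win_vectors :: (real ^ 'n::{finite,linorder}) set) = \<Union>F)"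
proof -
  define m where "m = CARD('n) ^ 2"
  have m: "0 < m" by (simp add: m_def)
  let ?G = "grid m :: (real ^ 'n::{finite,linorder} ^ 'n::{finite,linorder}) set"
  \<comment> \<open>The type has \<open>2 * m + 2\<close> elements, enough for the at most
    \<open>2 * m + 1\<close> grid values.\<close>
  have "2 * m + 1 \<le> CARD(('n \<times> 'n) option \<times> bool)"
    by (simp add: m_def power2_eq_square card_option)
  then obtain enc :: "real ^ 'n::{finite,linorder} ^ 'n::{finite,linorder} \<Rightarrow> ('n \<Rightarrow> 'n \<Rightarrow> ('n \<times> 'n) option \<times> bool)"
    where enc: "inj_on enc ?G"
    using ex_grid_encoding[where 'k = "('n \<times> 'n) option \<times> bool"] by blast
  have fin: "finite ?G" by (rule finite_imageD[OF _ enc]) simp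
  \<comment> \<open>One polytope of attainable values for each doubly monotonic grid point.\<close>
  define F where "F = (\<lambda>P. {g P | g. fair_on ?G g}) ` (doubly_monotonic \<inter> ?G)"
  have A: "map_win_vectors = {f P | f P. continuous_on matrices f \<and> fair_on matrices f \<and>
      P \<in> (doubly_monotonic :: (real ^ 'n::{finite,linorder} ^ 'n::{finite,linorder}) set)}"
    unfolding map_win_vectors_def by (intro Collect_cong ex_cong1) (use fair_on_matrices_iff in blast)
  have F: "map_win_vectors = \<Union>F"
  proof (intro equalityI subsetI)
    fix v :: "real ^ 'n::{finite,linorder}"
    assume "v \<in> map_win_vectors"
    then obtain f P where "fair_on matrices f" "P \<in> doubly_monotonic" "v = f P" unfolding A by blast
    then obtain P' g where "P' \<in> doubly_monotonic \<inter> ?G" "fair_on ?G g" "v = g P'"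
      using fair_value_on_grid[of f P m] by (auto simp: m_def)
    then show "v \<in> \<Union>F" unfolding F_def by blast
  next
    fix v assume "v \<in> \<Union>F"
    then obtain P g where P: "P \<in> doubly_monotonic" "P \<in> ?G" and g: "fair_on ?G g" "v = g P"
      by (auto simp: F_def)
    obtain f where "continuous_on matrices f" "fair_on matrices f" "\<forall>P\<in>?G. f P = g P"
      using fair_value_from_grid[OF g(1) m fin] by blast
    moreover from this have "v = f P" using P(2) g(2) by simp
    ultimately show "v \<in> map_win_vectors" unfolding A using P(1) by blast
  qed
  have "finite F" using fin by (simp add: F_def)
  moreover have poly: "\<forall>K\<in>F. polytope K"
    using polytope_fair_values[OF enc] by (auto simp: F_def)
  \<comment> \<open>Closedness reduces the inclusion of the closure to that of the individual win
    vectors.\<close>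
  ultimately have "closed (\<Union>F)" by (intro closed_Union) (auto intro: polytope_imp_closed)
  have "tournament_win_vectors \<subseteq> (map_win_vectors :: (real ^ 'n::{finite,linorder}) set)"
    unfolding tournament_win_vectors_def
  proof (rule closure_minimal)
    show "closed (map_win_vectors :: (real ^ 'n::{finite,linorder}) set)" using \<open>closed (\<Union>F)\<close> F by simp
    show "{win_vector T P | T P. is_tournament T \<and> symmetric_tournament T \<and> honest_tournament T \<and>
        P \<in> doubly_monotonic} \<subseteq> (map_win_vectors :: (real ^ 'n::{finite,linorder}) set)"
      unfolding map_win_vectors_def using fair_win_vector by blast
  qed
  moreover have "map_win_vectors \<subseteq> (tournament_win_vectors :: (real ^ 'n::{finite,linorder}) set)"
  proof
    fix v :: "real ^ 'n::{finite,linorder}"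
    assume "v \<in> map_win_vectors"
    then obtain f P where f: "fair_on matrices f" "continuous_on matrices f"
      and P: "P \<in> doubly_monotonic" "v = f P" unfolding A by blast
    have "P \<in> matrices" using P(1) by (simp add: doubly_monotonic_def)
    show "v \<in> tournament_win_vectors"
      unfolding tournament_win_vectors_def closure_approachable
    proof (intro allI impI)
      fix e :: real assume "0 < e"
      then obtain T where "is_tournament T" "symmetric_tournament T" "honest_tournament T"
        "dist (win_vector T P) v < e"
        using fair_map_approximable[OF f \<open>P \<in> matrices\<close>] P(2) by blast
      then show "\<exists>y\<in>{win_vector T P | T P. is_tournament T \<and> symmetric_tournament T \<and>
          honest_tournament T \<and> P \<in> doubly_monotonic}. dist y v < e"
        using P(1) by blast
    qed
  qed
  ultimately show ?thesis using F poly \<open>finite F\<close> by blast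
qed

end
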